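(* Let $J:\mathbb{R}^n\to\mathbb{R}$ be radially symmetric. Assume $\varepsilon_0>0$, $\beta\ge0$, and $$J\in L^1_{2+\beta}(\mathbb{R}^n)\cap L^{1+\varepsilon_0}_{\beta}(\mathbb{R}^n).$$ Let $N\ge\lceil\frac{1}{\varepsilon_0}\rceil+1$ be an integer, and let $$R_N(x,t)=e^{-\alpha_0t}\sum_{k=N}^\infty\frac{t^k}{k!}J_k(x),\qquad \alpha_0=\|J\|_{L^1}.$$ Then there is a constant $C$ independent of $x$ and $t$ such that $$|R_N(x,t)|\le C\left\langle\frac{\langle x\rangle^2}{\langle t\rangle}\right\rangle^{-\beta/2}\langle t\rangle^{-\frac n2}\qquad(\forall\,x\in\mathbb{R}^n,\ t\ge0).$$ In particular, if $J\in L^1_\infty(\mathbb{R}^n)\cap L^{1+\varepsilon_0}_\infty(\mathbb{R}^n)$ then this estimate is true for all $\beta\ge0$ (with $C$ depending on $\beta$).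
   Context: Notation: $\langle z\rangle=(1+|z|^2)^{1/2}$ for $z\in\mathbb{R}^n$ or $z\in\mathbb{R}$. $L^q_b(\mathbb{R}^n)$ is the set of measurable $f$ with $\|f\|_{L^q_b}:=\|\langle\cdot\rangle^b f\|_{L^q}<\infty$, and $L^q_\infty(\mathbb{R}^n)=\bigcap_{b\in\mathbb{R}}L^q_b(\mathbb{R}^n)$. $J_k=J*\cdots*J$ denotes the $k$-fold convolution of $J$ ($J_1=J$). *)

theory Defs
  imports "HOL-Analysis.Analysis"
begin

definition jbracket :: "'a::real_normed_vector \<Rightarrow> real" where
  "jbracket z = sqrt (1 + (norm z)\<^sup>2)"

definition radially_symmetric :: "('a::real_normed_vector \<Rightarrow> real) \<Rightarrow> bool" where
  "radially_symmetric f \<longleftrightarrow> (\<forall>x y. norm x = norm y \<longrightarrow> f x = f y)"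

text \<open>The weighted space $L^q_b$, intended for $1 \le q < \infty$: finiteness of the norm
  of $\langle\cdot\rangle^b f$ in $L^q$ is integrability of the $q$-th power of its absolute
  value. Elements are functions rather than classes modulo null sets.\<close>

definition weighted_L :: "real \<Rightarrow> real \<Rightarrow> ('a::euclidean_space \<Rightarrow> real) set" where
  "weighted_L q b = {f \<in> borel_measurable lebesgue.
     integrable lebesgue (\<lambda>x. \<bar>jbracket x powr b * f x\<bar> powr q)}"

definition weighted_L_inf :: "real \<Rightarrow> ('a::euclidean_space \<Rightarrow> real) set" where
  "weighted_L_inf q = (\<Inter>b. weighted_L q b)"

definition L1_norm :: "('a::euclidean_space \<Rightarrow> real) \<Rightarrow> real" where
  "L1_norm f = (LINT x|lebesgue. \<bar>f x\<bar>)"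

text \<open>The Bochner integral is $0$ where the integrand is not integrable, so this is everywhere
  defined. For two functions in $L^1$ the integrand is integrable for almost every $x$.\<close>

definition convolution :: "('a::euclidean_space \<Rightarrow> real) \<Rightarrow> ('a \<Rightarrow> real) \<Rightarrow> 'a \<Rightarrow> real" where
  "convolution f g x = (LINT y|lebesgue. f (x - y) * g y)"

text \<open>The k-fold convolution is meaningful for $k \ge 1$ only; the value at $k = 0$ is a dummy.\<close>

fun conv_power :: "('a::euclidean_space \<Rightarrow> real) \<Rightarrow> nat \<Rightarrow> 'a \<Rightarrow> real" where
  "conv_power f 0 = (\<lambda>x. 0)"
| "conv_power f (Suc 0) = f"
| "conv_power f (Suc (Suc k)) = convolution (conv_power f (Suc k)) f"

text \<open>The series over $k \ge N$, reindexed to start at $0$.\<close>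

definition remainder :: "('a::euclidean_space \<Rightarrow> real) \<Rightarrow> nat \<Rightarrow> 'a \<Rightarrow> real \<Rightarrow> real" where
  "remainder J N x t = exp (- L1_norm J * t) *
     (\<Sum>k. t ^ (N + k) / fact (N + k) * conv_power J (N + k) x)"

end

theory Submission
  imports Defs
begin

text \<open>Replacing \<open>J\<close> by \<open>\<bar>J\<bar> / \<alpha>\<^sub>0\<close>, one may take \<open>J\<close> to be an even probability density, and since the
  number of factors is then Poisson distributed, it suffices to show
  \<open>(1 + |x|\<^sup>2 / k) powr (\<beta> / 2) * J\<^sub>k x \<le> C * k powr (- n / 2)\<close> for \<open>k \<ge> N\<close>.
  For large \<open>k\<close>, split \<open>J\<^sub>k\<close> into two convolution factors of about \<open>k / 2\<close> terms; one summand of \<open>x\<close> carries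
  the weight, so a sup bound for one factor and a moment bound for the other are enough.

  Sup bound: \<open>J * J\<close> dominates a multiple of the uniform density of a cube, whose convolution powers
  reduce to products of one-dimensional simple random walks and decay like \<open>k powr (- n / 2)\<close>.
  Moment bound: the even integer \<open>2 m\<close> with \<open>\<beta> \<le> 2 m < \<beta> + 2\<close> is where the moment of order \<open>2 + \<beta>\<close> is
  used; by evenness, one convolution with \<open>J\<close> multiplies \<open>\<integral>(k + |x|\<^sup>2) ^ m\<close> by at most \<open>1 + C / k\<close>.
  For the finitely many small \<open>k\<close>, Young's inequality bounds the convolution of \<open>N\<close> copies of
  \<open>\<langle>x\<rangle> powr \<beta> * J\<close>: in a product of \<open>N\<close> numbers the least one is at most the geometric mean of the others,
  and \<open>1 + 1 / (N - 1) \<le> 1 + \<epsilon>\<^sub>0\<close>.\<close>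

section \<open>Convolution of nonnegative functions\<close>

text \<open>The obstacle is uniformity in \<open>k\<close>: a weight estimate applied factor by
  factor costs a constant to the power \<open>k\<close>. Measuring |x|^2 against the number of
  factors avoids this. Averaging over y and -y cancels the term of first order in y, so one factor
  costs \<open>1 + D / k\<close> and all of them together at most \<open>exp D\<close>; a surviving
  first-order term would cost 1 + D / sqrt k each, and that product is unbounded.

  The sup bound starts from J * J because J need not be bounded below on any ball, while a Steinhaus
  argument makes J * J positive near the origin. Instead of tail estimates for the number of uniform
  factors in a long convolution, a supersolution of the counting recursion is carried through an
  induction.

  In the Poisson average \<open>k\<close> may be far from t on either side, so both positive and
  negative moments of \<open>k / jbracket t\<close> have to be bounded.

  The estimate is claimed at every x, while J is controlled only up to null sets. A single
  convolution removes these, and N is at least 2.\<close>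

lemma nn_integral_lborel_uminus:
  fixes f :: "'a::euclidean_space \<Rightarrow> ennreal"
  assumes [measurable]: "f \<in> borel_measurable borel"
  shows "(\<integral>\<^sup>+x. f (- x) \<partial>lborel) = (\<integral>\<^sup>+x. f x \<partial>lborel)"
  by (subst lborel_affine[of "-1" 0])
    (simp_all add: nn_integral_density nn_integral_distr density_1 one_ennreal_def[symmetric])

lemma nn_integral_lborel_shift:
  fixes f :: "'a::euclidean_space \<Rightarrow> ennreal"
  assumes [measurable]: "f \<in> borel_measurable borel"
  shows "(\<integral>\<^sup>+x. f (x + c) \<partial>lborel) = (\<integral>\<^sup>+x. f x \<partial>lborel)"
  by (subst (2) lborel_distr_plus[of c, symmetric]) (simp add: nn_integral_distr add.commute)

lemma nn_integral_lborel_diff: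
  fixes f :: "'a::euclidean_space \<Rightarrow> ennreal"
  assumes [measurable]: "f \<in> borel_measurable borel"
  shows "(\<integral>\<^sup>+x. f (c - x) \<partial>lborel) = (\<integral>\<^sup>+x. f x \<partial>lborel)"
proof -
  have "(\<integral>\<^sup>+x. f (c - x) \<partial>lborel) = (\<integral>\<^sup>+x. f (- x + c) \<partial>lborel)" by (simp add: add.commute)
  also have "\<dots> = (\<integral>\<^sup>+x. f (x + c) \<partial>lborel)"
    by (rule nn_integral_lborel_uminus[of "\<lambda>x. f (x + c)"]) measurable
  finally show ?thesis by (simp add: nn_integral_lborel_shift)
qed

text \<open>Extended nonnegative values free Tonelli, commutativity and associativity of
  integrability conditions. The signed \<open>convolution\<close> is later dominated by it in
  absolute value.\<close>

definition nnconv :: "('a::euclidean_space \<Rightarrow> ennreal) \<Rightarrow> ('a \<Rightarrow> ennreal) \<Rightarrow> 'a \<Rightarrow> ennreal" where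
  "nnconv f g x = (\<integral>\<^sup>+y. f (x - y) * g y \<partial>lborel)"

lemma borel_measurable_nnconv [measurable]:
  assumes [measurable]: "f \<in> borel_measurable borel" "g \<in> borel_measurable borel"
  shows "nnconv f g \<in> borel_measurable borel"
  unfolding nnconv_def[abs_def] by measurable

lemma nnconv_commute:
  assumes [measurable]: "f \<in> borel_measurable borel" "g \<in> borel_measurable borel"
  shows "nnconv f g = nnconv g f"
proof
  fix x
  have "nnconv f g x = (\<integral>\<^sup>+y. f (x - (x - y)) * g (x - y) \<partial>lborel)"
    unfolding nnconv_def by (rule nn_integral_lborel_diff[symmetric]) measurable
  then show "nnconv f g x = nnconv g f x" by (simp add: nnconv_def mult.commute)
qed

text \<open>Tonelli and the substitution x = z + y. The weight is left free for three uses: a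
  constant gives total masses, a reflected translate of a factor gives associativity, a power of
  \<open>\<kappa> + (norm x)\<^sup>2\<close> gives the moment recursion.\<close>

lemma nn_integral_nnconv_weighted:
  assumes [measurable]: "f \<in> borel_measurable borel" "g \<in> borel_measurable borel"
    "\<phi> \<in> borel_measurable borel"
  shows "(\<integral>\<^sup>+x. \<phi> x * nnconv f g x \<partial>lborel)
    = (\<integral>\<^sup>+z. f z * (\<integral>\<^sup>+y. \<phi> (z + y) * g y \<partial>lborel) \<partial>lborel)"
proof -
  have "(\<integral>\<^sup>+x. \<phi> x * nnconv f g x \<partial>lborel)
      = (\<integral>\<^sup>+x. \<integral>\<^sup>+y. \<phi> x * (f (x - y) * g y) \<partial>lborel \<partial>lborel)"
    by (simp add: nnconv_def nn_integral_cmult)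
  also have "\<dots> = (\<integral>\<^sup>+y. \<integral>\<^sup>+x. \<phi> x * (f (x - y) * g y) \<partial>lborel \<partial>lborel)"
    by (rule lborel_pair.Fubini') measurable
  also have "\<dots> = (\<integral>\<^sup>+y. \<integral>\<^sup>+z. \<phi> (z + y) * (f z * g y) \<partial>lborel \<partial>lborel)"
  proof (rule nn_integral_cong)
    fix y
    show "(\<integral>\<^sup>+x. \<phi> x * (f (x - y) * g y) \<partial>lborel) = (\<integral>\<^sup>+z. \<phi> (z + y) * (f z * g y) \<partial>lborel)"
      using nn_integral_lborel_shift[of "\<lambda>x. \<phi> x * (f (x - y) * g y)" y] by simp
  qed
  also have "\<dots> = (\<integral>\<^sup>+z. \<integral>\<^sup>+y. \<phi> (z + y) * (f z * g y) \<partial>lborel \<partial>lborel)"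
    by (rule lborel_pair.Fubini') measurable
  also have "\<dots> = (\<integral>\<^sup>+z. f z * (\<integral>\<^sup>+y. \<phi> (z + y) * g y \<partial>lborel) \<partial>lborel)"
    by (simp add: nn_integral_cmult[symmetric] mult_ac)
  finally show ?thesis .
qed

lemma nn_integral_nnconv:
  assumes [measurable]: "f \<in> borel_measurable borel" "g \<in> borel_measurable borel"
  shows "(\<integral>\<^sup>+x. nnconv f g x \<partial>lborel) = (\<integral>\<^sup>+x. f x \<partial>lborel) * (\<integral>\<^sup>+x. g x \<partial>lborel)"
  using nn_integral_nnconv_weighted[of f g "\<lambda>_. 1"] by (simp add: nn_integral_multc)

lemma nnconv_assoc:
  assumes [measurable]: "f \<in> borel_measurable borel" "g \<in> borel_measurable borel"
    "h \<in> borel_measurable borel"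
  shows "nnconv (nnconv f g) h = nnconv f (nnconv g h)"
proof
  fix x
  have "nnconv f (nnconv h g) x = (\<integral>\<^sup>+z. h z * (\<integral>\<^sup>+y. f (x - (z + y)) * g y \<partial>lborel) \<partial>lborel)"
    unfolding nnconv_def[of f] by (rule nn_integral_nnconv_weighted) measurable
  also have "\<dots> = nnconv (nnconv f g) h x"
    unfolding nnconv_def[of "nnconv f g"] by (simp add: nnconv_def algebra_simps)
  finally show "nnconv (nnconv f g) h x = nnconv f (nnconv g h) x"
    by (simp add: nnconv_commute[of h g])
qed

lemma nnconv_le_bound:
  assumes [measurable]: "g \<in> borel_measurable borel" and "\<And>x. f x \<le> M"
  shows "nnconv f g x \<le> M * (\<integral>\<^sup>+y. g y \<partial>lborel)"
proof -
  have "nnconv f g x \<le> (\<integral>\<^sup>+y. M * g y \<partial>lborel)"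
    unfolding nnconv_def by (intro nn_integral_mono mult_right_mono) (auto intro: assms)
  then show ?thesis by (simp add: nn_integral_cmult)
qed

lemma nnconv_le_bound_right:
  assumes [measurable]: "f \<in> borel_measurable borel" "g \<in> borel_measurable borel"
    and "\<And>x. g x \<le> M"
  shows "nnconv f g x \<le> M * (\<integral>\<^sup>+y. f y \<partial>lborel)"
  using nnconv_le_bound[of f g M x] assms by (simp add: nnconv_commute[of f g])

text \<open>Index shift: \<open>nnconv_seq a k\<close> convolves the \<open>k + 1\<close> functions \<open>a 0, \<dots>, a k\<close>.\<close>

fun nnconv_seq :: "(nat \<Rightarrow> 'a::euclidean_space \<Rightarrow> ennreal) \<Rightarrow> nat \<Rightarrow> 'a \<Rightarrow> ennreal" where
  "nnconv_seq a 0 = a 0"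
| "nnconv_seq a (Suc k) = nnconv (nnconv_seq a k) (a (Suc k))"

abbreviation nnconv_pow :: "('a::euclidean_space \<Rightarrow> ennreal) \<Rightarrow> nat \<Rightarrow> 'a \<Rightarrow> ennreal" where
  "nnconv_pow f \<equiv> nnconv_seq (\<lambda>_. f)"

lemma borel_measurable_nnconv_seq [measurable]:
  assumes [measurable]: "\<And>i. a i \<in> borel_measurable borel"
  shows "nnconv_seq a k \<in> borel_measurable borel"
  by (induction k) auto

lemma nnconv_pow_add:
  assumes [measurable]: "f \<in> borel_measurable borel"
  shows "nnconv_pow f (Suc (i + j)) = nnconv (nnconv_pow f i) (nnconv_pow f j)"
proof (induction j)
  case (Suc j)
  have "nnconv_pow f (Suc (i + Suc j)) = nnconv (nnconv_pow f (Suc (i + j))) f" by simp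
  also have "\<dots> = nnconv (nnconv_pow f i) (nnconv_pow f (Suc j))"
    unfolding Suc.IH by (subst nnconv_assoc) auto
  finally show ?case .
qed simp

lemma nn_integral_nnconv_pow:
  assumes [measurable]: "f \<in> borel_measurable borel"
  shows "(\<integral>\<^sup>+x. nnconv_pow f k x \<partial>lborel) = (\<integral>\<^sup>+x. f x \<partial>lborel) ^ Suc k"
  by (induction k) (auto simp: nn_integral_nnconv mult_ac)

section \<open>Convolution powers of uniform densities\<close>

text \<open>Consecutive central coefficients have ratio 2 (2 m + 1) / (m + 1), and sqrt (2 m + 1) *
  sqrt (2 m + 3) is at most 2 m + 2, the geometric mean being below the arithmetic one.\<close>

lemma central_binomial_upper_bound:
  "real (2 * m choose m) * sqrt (2 * m + 1) \<le> 4 ^ m"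
proof (induction m)
  case (Suc m)
  have eq: "real (2 * Suc m choose Suc m) * (m + 1) = real (2 * m choose m) * (2 * (2 * m + 1))"
  proof -
    have a: "Suc (Suc (2 * m)) choose Suc m = 2 * (Suc (2 * m) choose m)"
      using binomial_symmetric[of m "Suc (2*m)"] by simp
    have "Suc m * (Suc (2 * m) choose Suc m) = Suc (2 * m) * (2 * m choose m)"
      using Suc_times_binomial_eq[of "2 * m" m] by (simp only: mult_ac)
    moreover have "Suc (2 * m) choose Suc m = Suc (2 * m) choose m"
      using binomial_symmetric[of m "Suc (2*m)"] by simp
    ultimately have "Suc m * (Suc (2 * m) choose m) = Suc (2 * m) * (2 * m choose m)" by simp
    moreover have "2 * Suc m choose Suc m = 2 * (Suc (2 * m) choose m)" using a by simp
    ultimately have "Suc m * (2 * Suc m choose Suc m) = 2 * (Suc (2 * m) * (2 * m choose m))"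
      by (metis mult.left_commute)
    then have "real (Suc m * (2 * Suc m choose Suc m)) = real (2 * (Suc (2 * m) * (2 * m choose m)))"
      by metis
    then show ?thesis by (simp add: algebra_simps)
  qed
  have sq: "sqrt (2 * m + 1) * sqrt (2 * Suc m + 1) \<le> 2 * (m + 1)"
  proof -
    have "(2 * real m + 1) * (2 * real (Suc m) + 1) \<le> (2 * (m + 1))\<^sup>2"
      by (simp add: power2_eq_square algebra_simps)
    from real_sqrt_le_mono[OF this] show ?thesis by (simp add: real_sqrt_mult add.commute)
  qed
  have "real (2 * Suc m choose Suc m) * sqrt (2 * Suc m + 1) * (m + 1)
      = (real (2 * m choose m) * sqrt (2 * m + 1)) * (2 * (sqrt (2 * m + 1) * sqrt (2 * Suc m + 1)))"
  proof -
    have "(real (2 * m choose m) * sqrt (2 * m + 1)) * (2 * (sqrt (2 * m + 1) * sqrt (2 * Suc m + 1)))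
       = (real (2 * m choose m) * (2 * (sqrt (2 * m + 1) * sqrt (2 * m + 1)))) * sqrt (2 * Suc m + 1)"
      by (simp only: mult_ac)
    also have "\<dots> = (real (2 * Suc m choose Suc m) * (m + 1)) * sqrt (2 * Suc m + 1)"
      unfolding eq by simp
    finally show ?thesis by (simp only: mult_ac)
  qed
  also have "\<dots> \<le> (4::real) ^ m * (2 * real (2 * (m + 1)))"
    using Suc sq by (intro mult_mono) auto
  also have "\<dots> = 4 ^ Suc m * real (m + 1)" by simp
  finally show ?case by (rule mult_right_le_imp_le) simp
qed simp

text \<open>The largest point mass of a simple random walk sits at the centre. For odd n = 2 m + 1,
  Pascal's rule bounds it through row 2 m, and the square root of the previous bound is then exactly
  \<open>sqrt n\<close>.\<close>

lemma binomial_le_two_power_div_sqrt: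
  "real (n choose k) \<le> 2 ^ n / sqrt n" if "n > 0"
proof -
  have "real (n choose (n div 2)) * sqrt n \<le> 2 ^ n"
  proof (cases "even n")
    case True
    then obtain m where n: "n = 2 * m" by auto
    have "real (n choose (n div 2)) * sqrt n \<le> real (2 * m choose m) * sqrt (2 * m + 1)"
      unfolding n by (intro mult_mono) auto
    also have "\<dots> \<le> 2 ^ n" using central_binomial_upper_bound[of m] by (simp add: n power_mult)
    finally show ?thesis .
  next
    case False
    then obtain m where n: "n = 2 * m + 1" by (metis oddE)
    have "n choose (n div 2) \<le> 2 * (2 * m choose m)"
    proof (cases m)
      case (Suc q)
      have "n choose (n div 2) = (2 * m choose m) + (2 * m choose q)"
        by (simp add: n Suc)
      then show ?thesis using binomial_maximum'[of m q] by simp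
    qed (simp add: n)
    then have "real (n choose (n div 2)) \<le> 2 * real (2 * m choose m)" by linarith
    then have "real (n choose (n div 2)) * sqrt n \<le> 2 * real (2 * m choose m) * sqrt n"
      by (intro mult_right_mono) auto
    also have "\<dots> \<le> 2 ^ n"
      using central_binomial_upper_bound[of m] by (simp add: n power_mult add.commute)
    finally show ?thesis .
  qed
  then have "real (n choose (n div 2)) \<le> 2 ^ n / sqrt n" using that by (simp add: field_simps)
  moreover have "real (n choose k) \<le> real (n choose (n div 2))"
    using binomial_maximum by simp
  ultimately show ?thesis by linarith
qed

text \<open>A uniform density on an interval of length \<open>2 * d\<close> averages two translates of a uniform
  density on an interval of length \<open>d\<close>; its convolution powers are therefore symmetric random walks
  of the convolution powers of the latter.\<close>

lemma nnconv_pow_average_translate: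
  fixes v :: "real \<Rightarrow> ennreal" and d :: real
  assumes [measurable]: "v \<in> borel_measurable borel"
  defines "u \<equiv> \<lambda>x. ennreal (1/2) * (v x + v (x + d))"
  shows "nnconv_pow u k x = (\<Sum>l\<le>Suc k. ennreal (real (Suc k choose l) / 2 ^ Suc k) * nnconv_pow v k (x + l * d))"
proof (induction k arbitrary: x)
  case 0
  then show ?case by (simp add: u_def distrib_left add.commute)
next
  case (Suc k)
  have [measurable]: "u \<in> borel_measurable borel" unfolding u_def by measurable
  let ?V = "nnconv_pow v (Suc k)" and ?p = "\<lambda>n l. ennreal (real (n choose l) / 2 ^ n)"
  have shift: "(\<integral>\<^sup>+y. nnconv_pow v k (z - y) * v (y + d) \<partial>lborel) = ?V (z + d)" for z
    using nn_integral_lborel_shift[of "\<lambda>y. nnconv_pow v k (z + d - y) * v y" d]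
    by (simp add: nnconv_def)
  have u_step: "(\<integral>\<^sup>+y. nnconv_pow v k (z - y) * u y \<partial>lborel) = ennreal (1/2) * (?V z + ?V (z + d))" for z
  proof -
    have "(\<integral>\<^sup>+y. nnconv_pow v k (z - y) * u y \<partial>lborel)
       = (\<integral>\<^sup>+y. ennreal (1/2) * (nnconv_pow v k (z - y) * v y + nnconv_pow v k (z - y) * v (y + d)) \<partial>lborel)"
      by (intro nn_integral_cong) (simp add: u_def distrib_left mult_ac)
    also have "\<dots> = ennreal (1/2) * (?V z + ?V (z + d))"
      by (simp add: nn_integral_cmult nn_integral_add shift) (simp add: nnconv_def)
    finally show ?thesis .
  qed
  have meas: "(\<lambda>y. c * (nnconv_pow v k (z - y) * u y)) \<in> borel_measurable lborel"
    "(\<lambda>y. nnconv_pow v k (z - y) * u y) \<in> borel_measurable lborel" for c z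
    by measurable
  have "nnconv_pow u (Suc k) x
      = (\<integral>\<^sup>+y. (\<Sum>l\<le>Suc k. ?p (Suc k) l * (nnconv_pow v k (x + l * d - y) * u y)) \<partial>lborel)"
    unfolding nnconv_seq.simps nnconv_def[of "nnconv_pow u k"] Suc.IH
    by (simp only: sum_distrib_right diff_add_eq mult.assoc)
  also have "\<dots> = (\<Sum>l\<le>Suc k. ?p (Suc k) l * (ennreal (1/2) * (?V (x + l * d) + ?V (x + l * d + d))))"
    by (subst nn_integral_sum) (simp_all only: u_step nn_integral_cmult meas)
  also have "\<dots> = (\<Sum>l\<le>Suc k. ennreal (real (Suc k choose l) / 2 ^ Suc (Suc k)) * ?V (x + l * d))
      + (\<Sum>l\<le>Suc k. ennreal (real (Suc k choose l) / 2 ^ Suc (Suc k)) * ?V (x + Suc l * d))"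
  proof -
    have *: "?p (Suc k) l * (ennreal (1/2) * (a + b))
        = ennreal (real (Suc k choose l) / 2 ^ Suc (Suc k)) * a + ennreal (real (Suc k choose l) / 2 ^ Suc (Suc k)) * b" for l a b
    proof -
      have "ennreal (real (Suc k choose l) / 2 ^ Suc (Suc k)) = ?p (Suc k) l * ennreal (1/2)"
        by (subst ennreal_mult[symmetric]) (auto simp: field_simps)
      then show ?thesis by (simp only: mult.assoc distrib_left)
    qed
    have "x + real l * d + d = x + real (Suc l) * d" for l by (simp add: algebra_simps)
    then show ?thesis by (simp only: * sum.distrib)
  qed
  \<comment> \<open>The two sums are offset by one translate; Pascal's rule merges their
    coefficients.\<close>
  also have "\<dots> = (\<Sum>l\<le>Suc (Suc k). ?p (Suc (Suc k)) l * ?V (x + l * d))"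
  proof -
    let ?q = "\<lambda>c. ennreal (real c / 2 ^ Suc (Suc k))"
    have q_add: "?q (a + b) = ?q a + ?q b" for a b
      by (simp add: add_divide_distrib ennreal_plus)
    have pascal: "Suc (Suc k) choose Suc l = (Suc k choose l) + (Suc k choose Suc l)" for l
      by (rule binomial_Suc_Suc)
    have "(\<Sum>l\<le>Suc (Suc k). ?p (Suc (Suc k)) l * ?V (x + l * d))
       = ?q 1 * ?V x + (\<Sum>l\<le>Suc k. ?q ((Suc k choose l) + (Suc k choose Suc l)) * ?V (x + Suc l * d))"
      by (subst sum.atMost_Suc_shift)
        (simp only: binomial_n_0 pascal of_nat_0 mult_zero_left add_0_right)
    also have "(\<Sum>l\<le>Suc k. ?q ((Suc k choose l) + (Suc k choose Suc l)) * ?V (x + Suc l * d))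
       = (\<Sum>l\<le>Suc k. ?q (Suc k choose l) * ?V (x + Suc l * d))
         + (\<Sum>l\<le>Suc k. ?q (Suc k choose Suc l) * ?V (x + Suc l * d))"
      by (simp only: q_add distrib_right sum.distrib)
    also have "?q 1 * ?V x + (\<dots>) = (\<Sum>l\<le>Suc k. ?q (Suc k choose l) * ?V (x + Suc l * d))
        + (?q 1 * ?V x + (\<Sum>l\<le>Suc k. ?q (Suc k choose Suc l) * ?V (x + Suc l * d)))"
      by (simp only: add_ac)
    also have "?q 1 * ?V x + (\<Sum>l\<le>Suc k. ?q (Suc k choose Suc l) * ?V (x + Suc l * d))
        = (\<Sum>l\<le>Suc (Suc k). ?q (Suc k choose l) * ?V (x + l * d))"
      by (subst (2) sum.atMost_Suc_shift)
        (simp only: binomial_n_0 of_nat_0 mult_zero_left add_0_right)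
    also have "\<dots> = (\<Sum>l\<le>Suc k. ?q (Suc k choose l) * ?V (x + l * d))"
      by (simp add: binomial_eq_0)
    finally show ?thesis by (simp only: add_ac)
  qed
  finally show ?case .
qed

text \<open>Translation commutes with convolution, so a sup bound for a sum of translates survives
  convolution with a density of mass at most one. The gain is that \<open>B\<close> need not grow
  with the number of translates when these do not overlap.\<close>

lemma sum_translates_nnconv_pow_le:
  fixes v :: "real \<Rightarrow> ennreal"
  assumes [measurable]: "v \<in> borel_measurable borel"
    and le: "\<And>x. (\<Sum>l\<le>n. v (x + real l * d)) \<le> B" and int: "(\<integral>\<^sup>+x. v x \<partial>lborel) \<le> 1"
  shows "(\<Sum>l\<le>n. nnconv_pow v k (x + real l * d)) \<le> B"
proof (induction k arbitrary: x)
  case (Suc k)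
  have "(\<Sum>l\<le>n. nnconv_pow v (Suc k) (x + real l * d))
      = (\<integral>\<^sup>+y. (\<Sum>l\<le>n. nnconv_pow v k (x - y + real l * d)) * v y \<partial>lborel)"
    by (simp add: nnconv_def nn_integral_sum[symmetric] sum_distrib_right diff_add_eq)
  also have "\<dots> \<le> (\<integral>\<^sup>+y. B * v y \<partial>lborel)"
    by (intro nn_integral_mono mult_right_mono Suc.IH) auto
  also have "\<dots> \<le> B" using int by (simp add: nn_integral_cmult mult_left_le)
  finally show ?case .
qed (use le in simp)

text \<open>Half open, so that the decomposition into two intervals of length \<open>d\<close> is
  exact at every point, with no exceptional endpoints.\<close>

definition interval_density :: "real \<Rightarrow> real \<Rightarrow> real" where
  "interval_density d x = indicator {-d..<d} x / (2 * d)"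

text \<open>All weights of the random walk are at most \<open>1 / sqrt (Suc k)\<close>; once this is
  pulled out, the remaining sum of translates is at most \<open>1 / d\<close>. The decay thus comes
  from the binomial coefficients alone.\<close>

lemma nnconv_pow_interval_density_le:
  assumes d: "d > 0"
  shows "nnconv_pow (\<lambda>x. ennreal (interval_density d x)) k x \<le> ennreal (1 / (d * sqrt (Suc k)))"
proof -
  define v :: "real \<Rightarrow> ennreal" where "v = (\<lambda>x. ennreal (indicator {0..<d} x / d))"
  have [measurable]: "v \<in> borel_measurable borel" unfolding v_def by measurable
  have half: "ennreal (1 / (2 * d)) = ennreal (1/2) * ennreal (1/d)"
    using d by (subst ennreal_mult[symmetric]) auto
  have u: "(\<lambda>x. ennreal (interval_density d x)) = (\<lambda>x. ennreal (1/2) * (v x + v (x + d)))"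
    using d by (auto simp: interval_density_def v_def indicator_def fun_eq_iff half)
  have int: "(\<integral>\<^sup>+x. v x \<partial>lborel) \<le> 1"
  proof -
    have "(\<integral>\<^sup>+x. v x \<partial>lborel) = (\<integral>\<^sup>+x. ennreal (1/d) * indicator {0..<d} x \<partial>lborel)"
      by (intro nn_integral_cong) (auto simp: v_def indicator_def)
    then show ?thesis using d by (simp add: nn_integral_cmult ennreal_mult[symmetric])
  qed
  \<comment> \<open>The translates of \<open>{0..<d}\<close> by multiples of \<open>d\<close> are
    disjoint, so at most one term is nonzero.\<close>
  have le: "(\<Sum>l\<le>n. v (y + real l * d)) \<le> ennreal (1 / d)" for y n
  proof -
    define A where "A = {l. l \<le> n \<and> 0 \<le> y + real l * d \<and> y + real l * d < d}"
    have "l = l'" if "l \<in> A" "l' \<in> A" for l l'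
    proof -
      have "\<bar>real l * d - real l' * d\<bar> < d" using that by (auto simp: A_def)
      then have "\<bar>real l - real l'\<bar> * d < 1 * d"
        using d by (simp add: abs_mult left_diff_distrib[symmetric])
      then have "\<bar>real l - real l'\<bar> < 1" using d by (simp only: mult_less_cancel_right_pos)
      then show ?thesis by linarith
    qed
    then have "card A \<le> 1" by (auto simp: card_le_Suc0_iff_eq A_def)
    have "(\<Sum>l\<le>n. v (y + real l * d)) = (\<Sum>l\<in>A. ennreal (1 / d))"
      by (rule sum.mono_neutral_cong_right) (auto simp: A_def v_def)
    also have "\<dots> \<le> 1 * ennreal (1 / d)"
      using \<open>card A \<le> 1\<close> by (simp add: mult_right_mono del: mult_1)
    finally show ?thesis by simp
  qed
  have "nnconv_pow (\<lambda>x. ennreal (interval_density d x)) k x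
      = (\<Sum>l\<le>Suc k. ennreal (real (Suc k choose l) / 2 ^ Suc k) * nnconv_pow v k (x + l * d))"
    unfolding u by (rule nnconv_pow_average_translate) measurable
  also have "\<dots> \<le> (\<Sum>l\<le>Suc k. ennreal (1 / sqrt (Suc k)) * nnconv_pow v k (x + l * d))"
    using binomial_le_two_power_div_sqrt[of "Suc k"]
    by (intro sum_mono mult_right_mono ennreal_leI) (auto simp: divide_simps mult_ac)
  also have "\<dots> = ennreal (1 / sqrt (Suc k)) * (\<Sum>l\<le>Suc k. nnconv_pow v k (x + l * d))"
    by (simp only: sum_distrib_left)
  also have "\<dots> \<le> ennreal (1 / sqrt (Suc k)) * ennreal (1 / d)"
    by (intro mult_left_mono sum_translates_nnconv_pow_le le int) auto
  finally show ?thesis using d by (simp add: ennreal_mult'[symmetric] mult.commute)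
qed

section \<open>Product densities on cubes\<close>

lemma nnconv_prod_Basis:
  fixes x :: "'a::euclidean_space"
  assumes [measurable]: "\<And>b. f b \<in> borel_measurable borel" "\<And>b. g b \<in> borel_measurable borel"
  shows "nnconv (\<lambda>x. \<Prod>b\<in>Basis. f b (x \<bullet> b)) (\<lambda>x. \<Prod>b\<in>Basis. g b (x \<bullet> b)) x
    = (\<Prod>b\<in>Basis. nnconv (f b) (g b) (x \<bullet> b))"
  unfolding nnconv_def inner_diff_left prod.distrib[symmetric]
  by (rule nn_integral_lborel_prod[where f = "\<lambda>b y. f b (x \<bullet> b - y) * g b y"]) auto

definition cube_density :: "real \<Rightarrow> 'a::euclidean_space \<Rightarrow> ennreal" where
  "cube_density d x = (\<Prod>b\<in>Basis. ennreal (interval_density d (x \<bullet> b)))"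

lemma borel_measurable_interval_density [measurable]: "interval_density d \<in> borel_measurable borel"
  unfolding interval_density_def[abs_def] by measurable

lemma borel_measurable_cube_density [measurable]: "cube_density d \<in> borel_measurable borel"
  unfolding cube_density_def[abs_def] by measurable

lemma nn_integral_interval_density:
  assumes "d > 0"
  shows "(\<integral>\<^sup>+x. ennreal (interval_density d x) \<partial>lborel) = 1"
proof -
  have "(\<integral>\<^sup>+x. ennreal (interval_density d x) \<partial>lborel)
      = (\<integral>\<^sup>+x. ennreal (1/(2*d)) * indicator {-d..<d} x \<partial>lborel)"
    by (intro nn_integral_cong) (auto simp: interval_density_def indicator_def)
  also have "\<dots> = ennreal (1 / (2 * d)) * ennreal (2 * d)"
    using assms by (simp add: nn_integral_cmult)
  also have "\<dots> = 1" using assms by (simp add: ennreal_mult[symmetric])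
  finally show ?thesis .
qed

lemma nn_integral_cube_density:
  assumes "d > 0"
  shows "(\<integral>\<^sup>+x. cube_density d (x::'a::euclidean_space) \<partial>lborel) = 1"
  unfolding cube_density_def using assms
  by (subst nn_integral_lborel_prod) (auto simp: nn_integral_interval_density)

lemma nnconv_pow_cube_density:
  "nnconv_pow (cube_density d) k (x::'a::euclidean_space)
    = (\<Prod>b\<in>Basis. nnconv_pow (\<lambda>y. ennreal (interval_density d y)) k (x \<bullet> b))"
proof (induction k arbitrary: x)
  case (Suc k)
  have "nnconv_pow (cube_density d) k = (\<lambda>x::'a. \<Prod>b\<in>Basis. nnconv_pow (\<lambda>y. ennreal (interval_density d y)) k (x \<bullet> b))"
    using Suc.IH by auto
  moreover have "cube_density d = (\<lambda>x::'a. \<Prod>b\<in>Basis. ennreal (interval_density d (x \<bullet> b)))"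
    by (auto simp: cube_density_def)
  ultimately show ?case
    using nnconv_prod_Basis[of "\<lambda>b. nnconv_pow (\<lambda>y. ennreal (interval_density d y)) k"
       "\<lambda>b y. ennreal (interval_density d y)" x] by simp
qed (simp add: cube_density_def)

lemma prod_mono_ennreal:
  fixes f g :: "'b \<Rightarrow> ennreal"
  assumes "\<And>i. i \<in> A \<Longrightarrow> f i \<le> g i"
  shows "prod f A \<le> prod g A"
  using assms by (induction A rule: infinite_finite_induct) (auto intro: mult_mono)

lemma nnconv_pow_cube_density_le:
  assumes d: "d > 0"
  shows "nnconv_pow (cube_density d) k (x::'a::euclidean_space)
    \<le> ennreal ((1 / d) ^ DIM('a) * (Suc k) powr (- real DIM('a) / 2))"
proof -
  have "nnconv_pow (cube_density d) k x \<le> (\<Prod>b\<in>(Basis::'a set). ennreal (1 / (d * sqrt (Suc k))))"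
    unfolding nnconv_pow_cube_density
    by (intro prod_mono_ennreal nnconv_pow_interval_density_le[OF d])
  also have "\<dots> = ennreal ((1 / (d * sqrt (Suc k))) ^ DIM('a))"
    using d by (simp add: ennreal_power)
  also have "(1 / (d * sqrt (Suc k))) ^ DIM('a) = (1 / d) ^ DIM('a) * (Suc k) powr (- real DIM('a) / 2)"
  proof -
    have "(1 / sqrt (Suc k)) ^ DIM('a) = (real (Suc k) powr (-1/2)) ^ DIM('a)"
      by (simp add: powr_half_sqrt[symmetric] powr_minus_divide[symmetric] del: of_nat_Suc)
    also have "\<dots> = (Suc k) powr (- real DIM('a) / 2)"
      by (simp add: powr_realpow[symmetric] powr_powr del: of_nat_Suc)
    finally have e: "(1 / sqrt (Suc k)) ^ DIM('a) = (Suc k) powr (- real DIM('a) / 2)" .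
    have "1 / (d * sqrt (Suc k)) = (1 / d) * (1 / sqrt (Suc k))" by simp
    then show ?thesis by (simp only: power_mult_distrib e)
  qed
  finally show ?thesis .
qed

text \<open>Picture a counter that advances by one with probability \<open>c\<close>. Its mean
  advance is \<open>c\<close>, but convexity of \<open>s powr - p\<close> works against replacing
  the counter by its mean. Giving up half of the advance pays for that: both sides are compared with
  the tangent-like value \<open>1 - p * (c / 2 / s)\<close>.\<close>

lemma powr_supersolution:
  fixes p c s :: real
  assumes p: "p \<ge> 0" and c: "0 \<le> c" "c \<le> 1" and s: "s \<ge> 1 + p"
  shows "c * (s + 1) powr - p + (1 - c) * s powr - p \<le> (s + c / 2) powr - p"
proof -
  have s0: "s > 0" using p s by linarith
  have split: "(s + z) powr - p = s powr - p * (1 + z / s) powr - p" if "z \<ge> 0" for z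
  proof -
    have "s + z = s * (1 + z / s)" using s0 by (simp add: field_simps)
    then show ?thesis using s0 that by (simp only: powr_mult)
  qed
  have lower: "1 - p * (c / 2 / s) \<le> (1 + c / 2 / s) powr - p"
  proof -
    have "ln (1 + c / 2 / s) \<le> c / 2 / s" using c s0 by (intro ln_add_one_self_le_self) auto
    then have "p * ln (1 + c / 2 / s) \<le> p * (c / 2 / s)" using p by (rule mult_left_mono)
    moreover have "1 + (- p * ln (1 + c / 2 / s)) \<le> exp (- p * ln (1 + c / 2 / s))"
      by (rule exp_ge_add_one_self)
    moreover have "0 < 1 + c / 2 / s" using c s0 by (simp add: add_pos_nonneg)
    ultimately show ?thesis by (simp add: powr_def)
  qed
  have upper: "(1 + 1 / s) powr - p \<le> 1 - p / 2 / s"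
  proof -
    have "1 / (s + 1) \<le> ln (1 + 1 / s)"
    proof -
      have "ln (s / (s + 1)) \<le> s / (s + 1) - 1" using s0 by (intro ln_le_minus_one) auto
      moreover have "s / (s + 1) - 1 = - (1 / (s + 1))" using s0 by (simp add: field_simps)
      moreover have "ln (1 + 1 / s) = - ln (s / (s + 1))"
        using s0 by (subst ln_inverse[symmetric]) (auto simp: field_simps)
      ultimately show ?thesis by linarith
    qed
    then have "p * (1 / (s + 1)) \<le> p * ln (1 + 1 / s)" using p by (rule mult_left_mono)
    moreover have "1 + p * ln (1 + 1 / s) \<le> exp (p * ln (1 + 1 / s))" by (rule exp_ge_add_one_self)
    moreover have "(1 + 1 / s) powr p = exp (p * ln (1 + 1 / s))"
      using add_pos_pos[of 1 "1 / s"] s0 by (simp add: powr_def)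
    ultimately have "1 + p / (s + 1) \<le> (1 + 1 / s) powr p"
      unfolding times_divide_eq_right mult_1_right by linarith
    then have "(1 + 1 / s) powr - p \<le> 1 / (1 + p / (s + 1))"
      using p s0 unfolding powr_minus_divide
      by (intro divide_left_mono) (auto intro!: mult_pos_pos add_pos_nonneg simp: add_nonneg_eq_0_iff)
    also have "\<dots> = 1 - p / (s + 1 + p)" using p s0 by (simp add: field_simps)
    \<comment> \<open>The assumption on \<open>s\<close> enters here, as s + 1 + p \<le> 2
      s.\<close>
    also have "\<dots> \<le> 1 - p / 2 / s"
      using p s s0 by (simp add: frac_le)
    finally show ?thesis .
  qed
  have "c * (s + 1) powr - p + (1 - c) * s powr - p
      = s powr - p * (c * (1 + 1 / s) powr - p + (1 - c))"
    using split[of 1] by (simp add: distrib_left right_diff_distrib left_diff_distrib)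
  also have "\<dots> \<le> s powr - p * (c * (1 - p / 2 / s) + (1 - c))"
    using c by (intro mult_left_mono add_right_mono upper) auto
  also have "\<dots> = s powr - p * (1 - p * (c / 2 / s))" by (simp add: algebra_simps)
  also have "\<dots> \<le> (s + c / 2) powr - p"
    using split[of "c / 2"] lower c by (auto intro!: mult_left_mono)
  finally show ?thesis .
qed

lemma borel_measurable_nnconv_iterate [measurable]:
  assumes [measurable]: "U \<in> borel_measurable borel" "\<phi> \<in> borel_measurable borel"
  shows "(nnconv U ^^ i) \<phi> \<in> borel_measurable borel"
  by (induction i) auto

lemma nnconv_iterate_commute:
  assumes [measurable]: "U \<in> borel_measurable borel" "h \<in> borel_measurable borel"
    "\<psi> \<in> borel_measurable borel"
  shows "(nnconv U ^^ i) (nnconv h \<psi>) = nnconv h ((nnconv U ^^ i) \<psi>)"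
proof (induction i)
  case (Suc i)
  have "(nnconv U ^^ Suc i) (nnconv h \<psi>) = nnconv U (nnconv h ((nnconv U ^^ i) \<psi>))"
    by (simp add: Suc.IH)
  also have "\<dots> = nnconv h (nnconv U ((nnconv U ^^ i) \<psi>))"
    by (subst (1 2) nnconv_assoc[symmetric]) (auto simp: nnconv_commute[of U h])
  finally show ?case by simp
qed simp

lemma nnconv_add_scaled:
  assumes [measurable]: "U \<in> borel_measurable borel" "h \<in> borel_measurable borel"
    "\<psi> \<in> borel_measurable borel"
  shows "nnconv (\<lambda>x. c * U x + h x) \<psi> x = c * nnconv U \<psi> x + nnconv h \<psi> x"
  unfolding nnconv_def by (simp add: distrib_right nn_integral_add nn_integral_cmult mult.assoc)

text \<open>Since \<open>U\<close> commutes with the mixture, splitting off one mixture factor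
  either adds a factor \<open>U\<close> with weight \<open>c\<close>, raising \<open>i\<close> by
  one, or adds \<open>h\<close>, which scales the supremum by at most \<open>1 - c\<close>. This is
  the recursion of \<open>powr_supersolution\<close>, so every mixture factor is worth
  \<open>c / 2\<close> factors \<open>U\<close>. The induction must range over all
  \<open>i\<close>.\<close>

lemma mixture_iterate_le:
  fixes U h \<phi> :: "'a::euclidean_space \<Rightarrow> ennreal" and A c p s :: real
  assumes [measurable]: "U \<in> borel_measurable borel" "h \<in> borel_measurable borel"
      "\<phi> \<in> borel_measurable borel"
    and c: "0 \<le> c" "c \<le> 1" and p: "p \<ge> 0" and s: "s \<ge> 1 + p" and A: "A \<ge> 0"
    and h: "(\<integral>\<^sup>+x. h x \<partial>lborel) \<le> ennreal (1 - c)"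
    and base: "\<And>i x. (nnconv U ^^ i) \<phi> x \<le> ennreal (A * (i + s) powr - p)"
  shows "(nnconv U ^^ i) ((nnconv (\<lambda>x. ennreal c * U x + h x) ^^ k) \<phi>) x
    \<le> ennreal (A * (i + s + k * (c / 2)) powr - p)"
proof (induction k arbitrary: i x)
  case (Suc k)
  define \<psi> where "\<psi> = (nnconv (\<lambda>x. ennreal c * U x + h x) ^^ k) \<phi>"
  have [measurable]: "\<psi> \<in> borel_measurable borel" unfolding \<psi>_def by measurable
  let ?W = "\<lambda>i. (nnconv U ^^ i) \<psi>" and ?z = "i + s + k * (c / 2)"
  have "(nnconv U ^^ i) (nnconv (\<lambda>x. ennreal c * U x + h x) \<psi>) x
      = nnconv (\<lambda>x. ennreal c * U x + h x) (?W i) x"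
    by (subst nnconv_iterate_commute) auto
  also have "\<dots> = ennreal c * ?W (Suc i) x + nnconv h (?W i) x"
    by (simp add: nnconv_add_scaled)
  also have "\<dots> \<le> ennreal c * ennreal (A * (?z + 1) powr - p)
      + ennreal (A * ?z powr - p) * ennreal (1 - c)"
  proof (intro add_mono mult_left_mono)
    show "?W (Suc i) x \<le> ennreal (A * (?z + 1) powr - p)"
      using Suc.IH[of "Suc i" x] by (simp add: \<psi>_def add_ac)
    have "nnconv h (?W i) x \<le> ennreal (A * ?z powr - p) * (\<integral>\<^sup>+y. h y \<partial>lborel)"
      using Suc.IH[of i] by (intro nnconv_le_bound_right) (auto simp: \<psi>_def)
    also have "\<dots> \<le> ennreal (A * ?z powr - p) * ennreal (1 - c)" by (intro mult_left_mono h) auto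
    finally show "nnconv h (?W i) x \<le> ennreal (A * ?z powr - p) * ennreal (1 - c)" .
  qed auto
  also have "\<dots> = ennreal (A * (c * (?z + 1) powr - p + (1 - c) * ?z powr - p))"
  proof -
    have "ennreal c * ennreal a + ennreal b * ennreal (1 - c) = ennreal (c * a + b * (1 - c))"
      if "a \<ge> 0" "b \<ge> 0" for a b
      using that c by (simp add: ennreal_mult ennreal_plus)
    note this[of "A * (?z + 1) powr - p" "A * ?z powr - p"]
    moreover have "c * (A * (?z + 1) powr - p) + (A * ?z powr - p) * (1 - c)
        = A * (c * (?z + 1) powr - p + (1 - c) * ?z powr - p)" by (simp add: algebra_simps)
    ultimately show ?thesis using A by (metis mult_nonneg_nonneg powr_ge_zero)
  qed
  also have "\<dots> \<le> ennreal (A * (?z + c / 2) powr - p)"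
  proof -
    have "real k * (c / 2) \<ge> 0" using c by simp
    then have "?z \<ge> 1 + p" using s by linarith
    then show ?thesis using c p A by (intro ennreal_leI mult_left_mono powr_supersolution)
  qed
  also have "?z + c / 2 = i + s + Suc k * (c / 2)" by (simp add: algebra_simps)
  finally show ?case by (simp add: \<psi>_def)
qed (use base in simp)

section \<open>Sup bound for convolution powers\<close>

text \<open>The bounded superlevel sets \<open>A n\<close> exhaust the set where \<open>f\<close> is
  nonzero, so one has positive measure. By inner regularity it contains a closed set missing less
  than its whole measure.\<close>

lemma nn_integral_pos_imp_compact_superlevel:
  fixes f :: "'a::euclidean_space \<Rightarrow> ennreal"
  assumes [measurable]: "f \<in> borel_measurable borel" and pos: "(\<integral>\<^sup>+x. f x \<partial>lborel) \<noteq> 0"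
  obtains K \<eta> where "compact K" "emeasure lborel K > 0" "\<eta> > (0::real)" "\<And>x. x \<in> K \<Longrightarrow> f x \<ge> ennreal \<eta>"
proof -
  define A where "A n = {x. f x \<ge> ennreal (1 / real (Suc n))} \<inter> cball 0 (real n)" for n
  have A [measurable]: "A n \<in> sets borel" for n unfolding A_def by measurable
  have "{x. f x \<noteq> 0} \<subseteq> (\<Union>n. A n)"
  proof
    fix x assume "x \<in> {x. f x \<noteq> 0}"
    then have "0 < f x" by (simp add: zero_less_iff_neq_zero)
    then obtain q where q: "0 < q" "q < f x" using dense by blast
    then obtain r where r: "q = ennreal r" by (cases q) auto
    then have "r > 0" using q by (simp add: ennreal_less_zero_iff)
    then obtain n where n: "1 / real (Suc n) < r" using nat_approx_posE by blast
    obtain m :: nat where m: "norm x \<le> real m" using real_arch_simple by blast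
    have "1 / real (Suc (max n m)) \<le> 1 / real (Suc n)" by (intro divide_left_mono) auto
    then have "ennreal (1 / real (Suc (max n m))) \<le> ennreal r" using n by (intro ennreal_leI) linarith
    then have "ennreal (1 / real (Suc (max n m))) \<le> f x" using q r by (metis less_imp_le order_trans)
    then have "x \<in> A (max n m)" using m by (auto simp: A_def)
    then show "x \<in> (\<Union>n. A n)" by blast
  qed
  moreover have "\<not> {x. f x \<noteq> 0} \<in> null_sets lborel"
  proof
    assume "{x. f x \<noteq> 0} \<in> null_sets lborel"
    then have "AE x in lborel. f x = 0" by (intro AE_I') auto
    then show False using pos by (simp add: nn_integral_0_iff_AE)
  qed
  moreover have "{x. f x \<noteq> 0} \<in> sets lborel" by measurable
  ultimately have "\<not> (\<forall>n. A n \<in> null_sets lborel)"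
    by (meson null_sets_UN null_sets_subset)
  then obtain n where "emeasure lborel (A n) \<noteq> 0" by (auto simp: null_sets_def)
  then have An: "emeasure lborel (A n) > 0" by (simp add: zero_less_iff_neq_zero)
  have fin: "emeasure lborel (A n) < \<infinity>"
  proof -
    have "emeasure lborel (A n) \<le> emeasure lborel (cball (0::'a) (real n))"
      by (intro emeasure_mono) (auto simp: A_def)
    then show ?thesis using emeasure_lborel_cball_finite[of 0 "real n"] by (metis order_le_less_trans)
  qed
  then obtain e where e: "emeasure lborel (A n) = ennreal e" "e > 0"
    using An by (metis ennreal_cases ennreal_less_zero_iff less_irrefl infinity_ennreal_def)
  have "A n \<in> sets lebesgue" by auto
  then obtain K where K: "closed K" "K \<subseteq> A n" "A n - K \<in> lmeasurable" "emeasure lebesgue (A n - K) < ennreal e"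
    using sets_lebesgue_inner_closed e by blast
  have "K \<subseteq> cball 0 (real n)" using K(2) by (auto simp: A_def)
  then have "bounded K" by (rule bounded_subset[OF bounded_cball])
  then have "compact K" using K by (simp add: compact_eq_bounded_closed)
  moreover have "emeasure lborel K > 0"
  proof (rule ccontr)
    assume "\<not> emeasure lborel K > 0"
    then have 0: "emeasure lborel K = 0" by simp
    have KB: "K \<in> sets borel" using K by auto
    have "emeasure lborel (A n) \<le> emeasure lborel (A n - K) + emeasure lborel K"
      using emeasure_subadditive[of "A n - K" lborel K] K KB
      by (simp add: Un_absorb2)
    also have "\<dots> < ennreal e" using K(4) 0 KB by simp
    finally show False using e by simp
  qed
  moreover have "f x \<ge> ennreal (1 / real (Suc n))" if "x \<in> K" for x using that K by (auto simp: A_def)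
  ultimately show ?thesis using that[of K "1 / real (Suc n)"] by simp
qed

text \<open>Steinhaus' argument. With 2 m the measure of \<open>K\<close>, choose an open
  neighbourhood of measure below 3 m. Small translates of \<open>K\<close> stay inside it, so
  \<open>K\<close> and its translate, of total measure 4 m, must share at least m.\<close>

lemma compact_translate_overlap:
  fixes K :: "'a::euclidean_space set"
  assumes K: "compact K" "emeasure lborel K > 0"
  obtains r m where "r > (0::real)" "m > (0::real)"
    "\<And>x. norm x < r \<Longrightarrow> emeasure lborel (K \<inter> {y. y - x \<in> K}) \<ge> ennreal m"
proof -
  have [measurable]: "K \<in> sets borel" using K by (simp add: borel_compact)
  have "emeasure lborel K < \<infinity>" using K emeasure_bounded_finite compact_imp_bounded by auto
  then obtain m where m: "emeasure lborel K = ennreal (2 * m)" "m > 0"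
    using K(2) by (metis ennreal_cases ennreal_less_zero_iff less_irrefl infinity_ennreal_def field_sum_of_halves mult_2 half_gt_zero)
  obtain T where T: "open T" "K \<subseteq> T" "T - K \<in> lmeasurable" "emeasure lebesgue (T - K) < ennreal m"
    using sets_lebesgue_outer_open[of K m] m by auto
  obtain r where r: "r > 0" "(\<Union>x\<in>K. ball x r) \<subseteq> T"
    using compact_subset_open_imp_ball_epsilon_subset[OF K(1) T(1,2)] .
  have "emeasure lborel (K \<inter> {y. y - x \<in> K}) \<ge> ennreal m" if x: "norm x < r" for x
  proof -
    let ?B = "{y. y - x \<in> K}"
    have B [measurable]: "?B \<in> sets borel" by measurable
    have eB: "emeasure lborel ?B = ennreal (2 * m)"
    proof -
      have "emeasure lborel ?B = (\<integral>\<^sup>+y. indicator ?B y \<partial>lborel)" by simp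
      also have "\<dots> = (\<integral>\<^sup>+y. indicator K (y + (- x)) \<partial>lborel)"
        by (intro nn_integral_cong) (simp add: indicator_def)
      also have "\<dots> = emeasure lborel K"
        by (subst nn_integral_lborel_shift) auto
      finally show ?thesis by (simp add: m)
    qed
    have BT: "?B \<subseteq> T"
    proof
      fix y assume "y \<in> ?B"
      then have "y - x \<in> K" "y \<in> ball (y - x) r" using x by (auto simp: dist_norm)
      then show "y \<in> T" using r by blast
    qed
    have "emeasure lborel (K \<union> ?B) \<le> emeasure lborel T"
      using BT T by (intro emeasure_mono) auto
    also have "\<dots> \<le> emeasure lborel (T - K) + emeasure lborel K"
      using emeasure_subadditive[of "T - K" lborel K] T by (simp add: Un_absorb2)
    also have "\<dots> \<le> ennreal m + ennreal (2 * m)"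
      using T m by (intro add_mono) (auto intro: less_imp_le)
    finally have U: "emeasure lborel (K \<union> ?B) \<le> ennreal (3 * m)"
      using m by (simp add: ennreal_plus[symmetric] del: ennreal_plus)
    have "ennreal (4 * m) = emeasure lborel K + emeasure lborel ?B"
      using m eB by (simp add: ennreal_plus[symmetric] del: ennreal_plus)
    also have "\<dots> = emeasure lborel (K \<union> ?B) + emeasure lborel (K \<inter> ?B)"
      by (rule emeasure_Un_Int) auto
    also have "\<dots> \<le> ennreal (3 * m) + emeasure lborel (K \<inter> ?B)"
      using U by (intro add_mono) auto
    finally have "ennreal (3 * m) + ennreal m \<le> ennreal (3 * m) + emeasure lborel (K \<inter> ?B)"
      using m by (simp add: ennreal_plus[symmetric] del: ennreal_plus)
    then show ?thesis by (simp add: ennreal_add_left_cancel_le)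
  qed
  with r m show ?thesis using that by blast
qed

text \<open>Evenness turns \<open>f (x - y) * f y\<close> into \<open>f (y - x) * f y\<close>, which
  is at least \<open>\<eta> * \<eta>\<close> whenever \<open>y\<close> lies in both the compact
  superlevel set and its translate by \<open>x\<close>.\<close>

lemma nnconv_self_lower_bound:
  fixes f :: "'a::euclidean_space \<Rightarrow> ennreal"
  assumes [measurable]: "f \<in> borel_measurable borel" and even: "\<And>x. f (- x) = f x"
    and pos: "(\<integral>\<^sup>+x. f x \<partial>lborel) \<noteq> 0"
  obtains r c where "r > (0::real)" "c > (0::real)" "\<And>x. norm x < r \<Longrightarrow> nnconv f f x \<ge> ennreal c"
proof -
  obtain K \<eta> where K: "compact K" "emeasure lborel K > 0" "\<eta> > 0" "\<And>x. x \<in> K \<Longrightarrow> f x \<ge> ennreal \<eta>"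
    using nn_integral_pos_imp_compact_superlevel[OF assms(1) pos] by blast
  obtain r m where r: "r > 0" "m > 0" "\<And>x. norm x < r \<Longrightarrow> emeasure lborel (K \<inter> {y. y - x \<in> K}) \<ge> ennreal m"
    using compact_translate_overlap[OF K(1,2)] by blast
  have [measurable]: "K \<in> sets borel" using K by (simp add: borel_compact)
  have "nnconv f f x \<ge> ennreal (\<eta> * \<eta> * m)" if x: "norm x < r" for x
  proof -
    have "ennreal (\<eta> * \<eta> * m) = ennreal (\<eta> * \<eta>) * ennreal m"
      using r K by (simp add: ennreal_mult)
    also have "\<dots> \<le> ennreal (\<eta> * \<eta>) * emeasure lborel (K \<inter> {y. y - x \<in> K})"
      using r(3)[OF x] by (rule mult_left_mono) auto
    also have "\<dots> = (\<integral>\<^sup>+y. ennreal (\<eta> * \<eta>) * indicator (K \<inter> {y. y - x \<in> K}) y \<partial>lborel)"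
      by (simp add: nn_integral_cmult)
    also have "\<dots> \<le> (\<integral>\<^sup>+y. f (x - y) * f y \<partial>lborel)"
    proof (rule nn_integral_mono)
      fix y
      have "f (x - y) = f (y - x)" using even[of "y - x"] by simp
      then show "ennreal (\<eta> * \<eta>) * indicator (K \<inter> {y. y - x \<in> K}) y \<le> f (x - y) * f y"
        using K(3,4) by (auto simp: indicator_def ennreal_mult intro!: mult_mono)
    qed
    finally show ?thesis by (simp add: nnconv_def)
  qed
  with r K show ?thesis using that[of r "\<eta> * \<eta> * m"] by simp
qed

lemma cube_density_le:
  assumes "d > 0"
  shows "cube_density d (x::'a::euclidean_space) \<le> ennreal ((1 / (2 * d)) ^ DIM('a))"
proof -
  have "cube_density d x \<le> (\<Prod>b\<in>(Basis::'a set). ennreal (1 / (2 * d)))"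
    unfolding cube_density_def using assms
    by (intro prod_mono_ennreal ennreal_leI) (auto simp: interval_density_def indicator_def)
  also have "\<dots> = ennreal ((1 / (2 * d)) ^ DIM('a))"
    using assms by (simp add: ennreal_power)
  finally show ?thesis .
qed

lemma cube_density_eq_0:
  fixes d :: real
  assumes "norm (x::'a::euclidean_space) > DIM('a) * d"
  shows "cube_density d x = 0"
proof -
  have "norm x \<le> DIM('a) * d" if "\<forall>b\<in>Basis. \<bar>x \<bullet> b\<bar> \<le> d"
    using norm_le_l1[of x] sum_bounded_above[of Basis "\<lambda>b. \<bar>x \<bullet> b\<bar>" d] that by auto
  then obtain b where "b \<in> Basis" "\<bar>x \<bullet> b\<bar> > d" using assms by force
  then show ?thesis
    unfolding cube_density_def by (intro prod_zero) (auto simp: interval_density_def indicator_def intro!: bexI[of _ b])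
qed

text \<open>Since \<open>f * f\<close> dominates a multiple of a uniform density \<open>U\<close>, write \<open>f * f = c U + h\<close>; the
  number of factors \<open>U\<close> in a long convolution is then typically proportional to its length.\<close>

lemma nnconv_pow_sup_decay:
  fixes f :: "'a::euclidean_space \<Rightarrow> ennreal" and M :: real
  assumes [measurable]: "f \<in> borel_measurable borel" and even: "\<And>x. f (- x) = f x"
    and int: "(\<integral>\<^sup>+x. f x \<partial>lborel) = 1" and bdd: "\<And>x. nnconv_pow f N x \<le> ennreal M"
  shows "\<exists>C\<ge>0. \<forall>k\<ge>N. \<forall>x. nnconv_pow f k x \<le> ennreal (C * (Suc k) powr (- real DIM('a) / 2))"
proof -
  define p where "p = real DIM('a) / 2"
  have p: "p > 0" by (simp add: p_def)
  obtain r c0 where r: "r > 0" "c0 > 0" "\<And>x. norm x < r \<Longrightarrow> nnconv f f x \<ge> ennreal c0"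
    using nnconv_self_lower_bound[of f] even int by auto
  \<comment> \<open>As \<open>DIM('a) * d = r / 2\<close>, the cube lies inside the ball of radius
    \<open>r\<close>. The factor \<open>c\<close> rescales the height of the uniform density to
    \<open>c0\<close>.\<close>
  define d where "d = r / (2 * DIM('a))"
  define U :: "'a \<Rightarrow> ennreal" where "U = cube_density d"
  define c where "c = c0 * (2 * d) ^ DIM('a)"
  have d: "d > 0" and c0: "c > 0" using r by (auto simp: d_def c_def)
  have [measurable]: "U \<in> borel_measurable borel" by (simp add: U_def)
  have U_int: "(\<integral>\<^sup>+x. U x \<partial>lborel) = 1" unfolding U_def by (rule nn_integral_cube_density[OF d])
  have cU: "ennreal c * U x \<le> nnconv f f x" for x
  proof (cases "norm x < r")
    case True
    have "ennreal c * U x \<le> ennreal c * ennreal ((1 / (2 * d)) ^ DIM('a))"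
      unfolding U_def by (intro mult_left_mono cube_density_le d) auto
    also have "\<dots> = ennreal c0"
      using d r by (simp add: ennreal_mult[symmetric] c_def power_divide)
    finally show ?thesis using r(3)[OF True] by (rule order_trans)
  next
    case False
    then have "norm x > DIM('a) * d" using r by (simp add: d_def)
    then show ?thesis by (simp add: U_def cube_density_eq_0[of d x])
  qed
  have Ufin: "ennreal c * U x \<noteq> top" for x
  proof -
    have "U x \<noteq> top" unfolding U_def using cube_density_le[OF d, of x] by (metis ennreal_neq_top top_unique)
    then show ?thesis by (simp add: ennreal_mult_eq_top_iff)
  qed
  define h where "h x = nnconv f f x - ennreal c * U x" for x
  have [measurable]: "h \<in> borel_measurable borel" unfolding h_def[abs_def] by measurable
  have split: "nnconv f f = (\<lambda>x. ennreal c * U x + h x)"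
  proof
    fix x show "nnconv f f x = ennreal c * U x + h x"
      unfolding h_def by (metis add.commute cU diff_add_cancel_ennreal)
  qed
  have f2: "(\<integral>\<^sup>+x. nnconv f f x \<partial>lborel) = 1" by (simp add: nn_integral_nnconv int)
  have tot: "ennreal c + (\<integral>\<^sup>+x. h x \<partial>lborel) = 1"
    using f2 unfolding split by (simp add: nn_integral_add nn_integral_cmult U_int)
  have c1: "c \<le> 1"
  proof -
    have "ennreal c \<le> ennreal c + (\<integral>\<^sup>+x. h x \<partial>lborel)" by (rule order_trans[OF _ add_left_mono[OF zero_le]]) simp
    then show ?thesis unfolding tot by simp
  qed
  have h_int: "(\<integral>\<^sup>+x. h x \<partial>lborel) \<le> ennreal (1 - c)"
  proof -
    have "ennreal c + (\<integral>\<^sup>+x. h x \<partial>lborel) \<le> ennreal c + ennreal (1 - c)"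
      using c0 c1 tot by (simp add: ennreal_plus[symmetric] del: ennreal_plus)
    then show ?thesis by (simp add: ennreal_add_left_cancel_le)
  qed
  \<comment> \<open>The least start that \<open>powr_supersolution\<close> allows. In
    \<open>A\<close>, the first summand serves \<open>i = 0\<close>, where only the bound
    \<open>M\<close> on the seed \<open>nnconv_pow f N\<close> is available; the second serves
    \<open>i \<ge> 1\<close> through the decay of the cube densities and i + s \<le> i (1 +
    s).\<close>
  define s where "s = 1 + p"
  define A where "A = max M 0 * s powr p + (1 / d) ^ DIM('a) * (1 + s) powr p"
  have A: "A \<ge> 0" using d by (simp add: A_def)
  let ?\<phi> = "nnconv_pow f N"
  have phi_int: "(\<integral>\<^sup>+x. ?\<phi> x \<partial>lborel) = 1" by (simp add: nn_integral_nnconv_pow int)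
  have base: "(nnconv U ^^ i) ?\<phi> x \<le> ennreal (A * (i + s) powr - p)" for i x
  proof (cases i)
    case 0
    have "M \<le> A * s powr - p"
    proof -
      have "M \<le> max M 0 * (s powr p * s powr - p)"
        using p by (simp add: s_def powr_add[symmetric])
      also have "\<dots> \<le> A * s powr - p"
        using d by (simp add: A_def distrib_right mult.assoc)
      finally show ?thesis .
    qed
    then show ?thesis using bdd[of x] 0 by (auto intro: order_trans ennreal_leI)
  next
    case (Suc j)
    have it: "(nnconv U ^^ Suc j) ?\<phi> = nnconv (nnconv_pow U j) ?\<phi>" for j
    proof (induction j)
      case (Suc j)
      have "(nnconv U ^^ Suc (Suc j)) ?\<phi> = nnconv U (nnconv (nnconv_pow U j) ?\<phi>)"
        using Suc.IH by simp
      also have "\<dots> = nnconv (nnconv_pow U (Suc j)) ?\<phi>"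
        by (subst nnconv_assoc[symmetric]) (auto simp: nnconv_commute[of U])
      finally show ?case .
    qed simp
    have "(nnconv U ^^ i) ?\<phi> x \<le> ennreal ((1 / d) ^ DIM('a) * (Suc j) powr (- real DIM('a) / 2))"
    proof -
      have "nnconv (nnconv_pow U j) ?\<phi> x
          \<le> ennreal ((1 / d) ^ DIM('a) * (Suc j) powr (- real DIM('a) / 2)) * (\<integral>\<^sup>+y. ?\<phi> y \<partial>lborel)"
        unfolding U_def by (rule nnconv_le_bound[OF _ nnconv_pow_cube_density_le[OF d]]) measurable
      then show ?thesis by (simp only: Suc it phi_int mult_1_right)
    qed
    also have "\<dots> \<le> ennreal (A * (i + s) powr - p)"
    proof (rule ennreal_leI)
      have "(real i + s) powr p \<le> (i * (1 + s)) powr p"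
        using p Suc by (intro powr_mono2) (auto simp: s_def algebra_simps add_nonneg_nonneg)
      also have "\<dots> = i powr p * (1 + s) powr p" using p by (simp add: powr_mult s_def)
      finally have "i powr - p \<le> (1 + s) powr p * (i + s) powr - p"
        using p Suc by (simp add: powr_minus_divide s_def field_simps add_pos_pos)
      then have "(1 / d) ^ DIM('a) * i powr - p \<le> (1 / d) ^ DIM('a) * ((1 + s) powr p * (i + s) powr - p)"
        using d by (intro mult_left_mono) auto
      also have "\<dots> \<le> A * (i + s) powr - p"
        unfolding A_def by (simp add: distrib_right mult.assoc)
      finally show "(1 / d) ^ DIM('a) * (Suc j) powr (- real DIM('a) / 2) \<le> A * (i + s) powr - p"
        by (simp add: Suc p_def)
    qed
    finally show ?thesis .
  qed
  have iter: "(nnconv (nnconv f f) ^^ j) ?\<phi> = nnconv_pow f (N + 2 * j)" for j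
  proof (induction j)
    case (Suc j)
    have "(nnconv (nnconv f f) ^^ Suc j) ?\<phi> = nnconv (nnconv_pow f 1) (nnconv_pow f (N + 2 * j))"
      using Suc.IH by simp
    also have "\<dots> = nnconv_pow f (Suc (1 + (N + 2 * j)))" by (rule nnconv_pow_add[symmetric]) simp
    finally show ?case by (simp add: numeral_2_eq_2 del: nnconv_seq.simps)
  qed simp
  have evenbd: "nnconv_pow f (N + 2 * j) x \<le> ennreal (A * (s + j * (c / 2)) powr - p)" for j x
    using mixture_iterate_le[of U h ?\<phi> c p s A 0 j x] c0 c1 p A h_int base
    by (simp add: s_def split[symmetric] iter)
  \<comment> \<open>A mixture factor is \<open>nnconv f f\<close>, so iteration reaches every second
    index. One more convolution with a probability density does not raise the supremum.\<close>
  have oddbd: "nnconv_pow f (N + 2 * j + 1) x \<le> ennreal (A * (s + j * (c / 2)) powr - p)" for j x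
    using nnconv_le_bound[of f "nnconv_pow f (N + 2 * j)" _ x] evenbd[of j] int by simp
  \<comment> \<open>From \<open>Suc k\<close> \<le> (N + 2) (1 + 2 j) and 1 + 2 j \<le> (4 / c) (s +
    j c / 2), the latter because c \<le> 1 \<le> s.\<close>
  define C where "C = A * ((real N + 2) * (4 / c)) powr p"
  have "nnconv_pow f k x \<le> ennreal (C * (Suc k) powr - p)" if k: "k \<ge> N" for k x
  proof -
    define j where "j = (k - N) div 2"
    have kj: "k = N + 2 * j \<or> k = N + 2 * j + 1" unfolding j_def using k by presburger
    have "nnconv_pow f k x \<le> ennreal (A * (s + j * (c / 2)) powr - p)"
      using kj evenbd oddbd by auto
    also have "\<dots> \<le> ennreal (C * (Suc k) powr - p)"
    proof (rule ennreal_leI)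
      have sp: "s + j * (c / 2) > 0" using p c0 by (simp add: s_def add_pos_nonneg)
      have "real (Suc k) \<le> (real N + 2) * (1 + 2 * real j)" using kj by (auto simp: algebra_simps)
      also have "\<dots> \<le> (real N + 2) * ((4 / c) * (s + j * (c / 2)))"
      proof (rule mult_left_mono)
        have "1 \<le> 4 / c * s" using c0 c1 p by (simp add: s_def field_simps)
        then show "1 + 2 * real j \<le> (4 / c) * (s + j * (c / 2))" using c0 by (simp add: distrib_left)
      qed auto
      finally have "real (Suc k) \<le> (real N + 2) * ((4 / c) * (s + j * (c / 2)))" .
      then have "real (Suc k) powr p \<le> ((real N + 2) * (4 / c) * (s + j * (c / 2))) powr p"
        unfolding mult.assoc using p by (intro powr_mono2) auto
      also have "\<dots> = ((real N + 2) * (4 / c)) powr p * (s + j * (c / 2)) powr p"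
        using sp c0 by (subst powr_mult) auto
      finally have "(s + j * (c / 2)) powr - p \<le> ((real N + 2) * (4 / c)) powr p * (Suc k) powr - p"
        using sp by (simp add: powr_minus_divide field_simps del: of_nat_Suc)
      then show "A * (s + j * (c / 2)) powr - p \<le> C * (Suc k) powr - p"
        unfolding C_def mult.assoc using A by (intro mult_left_mono) auto
    qed
    finally show ?thesis .
  qed
  moreover have "C \<ge> 0" using A by (simp add: C_def)
  ultimately show ?thesis unfolding p_def by (auto intro!: exI[of _ C])
qed

section \<open>Moments of convolution powers\<close>

text \<open>\<open>P m\<close> and \<open>Q m\<close> are the parts of \<open>(A + b) ^ m\<close>
  that are even and odd in \<open>b\<close>. They satisfy a linear recursion like that of cosh and
  sinh, in which \<open>b * Q m\<close> is at most \<open>real m * b\<^sup>2 / A * P m\<close>. So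
  \<open>P\<close> grows by a factor containing \<open>b\<close> only through its square.\<close>

lemma symmetric_power_le:
  fixes A b :: real
  assumes A: "A > 0" and b: "\<bar>b\<bar> \<le> A"
  shows "((A + b) ^ m + (A - b) ^ m) / 2 \<le> (A + real m * b\<^sup>2 / A) ^ m"
proof -
  define P Q where "P m = ((A + b) ^ m + (A - b) ^ m) / 2" and "Q m = ((A + b) ^ m - (A - b) ^ m) / 2" for m
  have P_Suc: "P (Suc m) = A * P m + b * Q m" and Q_Suc: "Q (Suc m) = A * Q m + b * P m" for m
    by (simp_all add: P_def Q_def field_simps)
  have P0: "P m \<ge> 0" for m using b by (auto simp: P_def)
  have bQ: "0 \<le> b * Q m \<and> A * (b * Q m) \<le> real m * b\<^sup>2 * P m" for m
  proof (induction m)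
    case (Suc m)
    have "A * P m \<le> P (Suc m)" using Suc by (simp add: P_Suc)
    then have "(1 + real m) * b\<^sup>2 * (A * P m) \<le> (1 + real m) * b\<^sup>2 * P (Suc m)"
      by (intro mult_left_mono) auto
    moreover have eq: "b * Q (Suc m) = A * (b * Q m) + b\<^sup>2 * P m"
      by (simp add: Q_Suc algebra_simps power2_eq_square)
    then have "A * (b * Q (Suc m)) \<le> A * (real m * b\<^sup>2 * P m + b\<^sup>2 * P m)"
      using A Suc by (intro mult_left_mono) auto
    moreover have "0 \<le> b * Q (Suc m)" using Suc A P0[of m] unfolding eq by auto
    ultimately show ?case by (simp add: algebra_simps)
  qed (simp add: Q_def)
  \<comment> \<open>The growth factor is frozen at the final \<open>m\<close> while the exponent
    runs up to it.\<close>
  have "P k \<le> (A + real m * b\<^sup>2 / A) ^ k" if "k \<le> m" for k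
    using that
  proof (induction k)
    case (Suc k)
    have "b * Q k \<le> real k * b\<^sup>2 / A * P k" using bQ[of k] A by (simp add: field_simps)
    also have "\<dots> \<le> real m * b\<^sup>2 / A * P k"
      using Suc A P0[of k] by (intro mult_right_mono divide_right_mono) auto
    finally have "P (Suc k) \<le> (A + real m * b\<^sup>2 / A) * P k" by (simp add: P_Suc algebra_simps)
    also have "\<dots> \<le> (A + real m * b\<^sup>2 / A) * (A + real m * b\<^sup>2 / A) ^ k"
      using Suc A by (intro mult_left_mono) auto
    finally show ?case by simp
  qed (simp add: P_def)
  then show ?thesis by (simp add: P_def)
qed

text \<open>Convexity in 1 / \<kappa>: the right-hand side is the chord of (1 + q t)^m over t in
  [0, 1]. It isolates a single power of 1 / \<kappa>.\<close>

lemma power_one_add_divide_le: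
  fixes q \<kappa> :: real
  assumes "q \<ge> 0" "\<kappa> \<ge> 1"
  shows "(1 + q / \<kappa>) ^ m \<le> 1 + ((1 + q) ^ m - 1) / \<kappa>"
proof (induction m)
  case (Suc m)
  have B: "(1 + q) ^ m \<ge> 1" using assms by (simp add: one_le_power)
  have "(1 + q / \<kappa>) ^ Suc m \<le> (1 + q / \<kappa>) * (1 + ((1 + q) ^ m - 1) / \<kappa>)"
    using Suc assms by (simp add: mult_left_mono)
  also have "\<dots> = 1 + ((1 + q) ^ m - 1 + q + ((1 + q) ^ m - 1) * q / \<kappa>) / \<kappa>"
    using assms by (simp add: field_simps)
  also have "\<dots> \<le> 1 + ((1 + q) ^ m - 1 + q + ((1 + q) ^ m - 1) * q) / \<kappa>"
  proof -
    have "0 \<le> ((1 + q) ^ m - 1) * q" using assms B by simp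
    then have "((1 + q) ^ m - 1) * q * 1 \<le> ((1 + q) ^ m - 1) * q * \<kappa>"
      using assms by (intro mult_left_mono)
    then show ?thesis using assms by (intro add_left_mono divide_right_mono) (auto simp: divide_le_eq)
  qed
  also have "\<dots> = 1 + ((1 + q) ^ Suc m - 1) / \<kappa>" by (simp add: algebra_simps)
  finally show ?case .
qed simp

text \<open>The two bases are \<open>A + b\<close> and \<open>A - b\<close>, with \<open>b\<close>
  the cross term. Cauchy-Schwarz gives \<open>b\<^sup>2 / A \<le> 4 * (norm y)\<^sup>2\<close>;
  together with the square of \<open>norm y\<close> inside \<open>A\<close> this produces
  \<open>4 * real m + 1\<close>. As \<open>W \<ge> \<kappa>\<close>, the increment is relative to
  \<open>W\<close> of order 1 / \<kappa>.\<close>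

lemma symmetric_norm_power_le:
  fixes s y :: "'a::real_inner" and \<kappa> :: real
  assumes \<kappa>: "\<kappa> \<ge> 1"
  shows "((\<kappa> + (norm (s + y))\<^sup>2) ^ m + (\<kappa> + (norm (s - y))\<^sup>2) ^ m) / 2
    \<le> (\<kappa> + (norm s)\<^sup>2) ^ m * (1 + (1 + (4 * real m + 1) * (norm y)\<^sup>2) ^ m / \<kappa>)"
proof -
  define W where "W = \<kappa> + (norm s)\<^sup>2"
  define A where "A = W + (norm y)\<^sup>2"
  define b where "b = 2 * (s \<bullet> y)"
  have W: "W \<ge> \<kappa>" and A: "A > 0" "A \<ge> (norm s)\<^sup>2" using \<kappa> by (auto simp: W_def A_def add_pos_nonneg)
  have cs: "\<bar>b\<bar> \<le> 2 * (norm s * norm y)" using Cauchy_Schwarz_ineq2[of s y] by (simp add: b_def abs_mult)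
  also have "\<dots> \<le> (norm s)\<^sup>2 + (norm y)\<^sup>2"
    using sum_squares_bound[of "norm s" "norm y"] by simp
  finally have bA: "\<bar>b\<bar> \<le> A" using \<kappa> by (simp add: A_def W_def)
  have "b\<^sup>2 \<le> (2 * (norm s * norm y))\<^sup>2" using cs by (metis abs_ge_zero power2_abs power_mono)
  also have "\<dots> = (norm s)\<^sup>2 * (4 * (norm y)\<^sup>2)" by (simp add: power_mult_distrib)
  also have "\<dots> \<le> A * (4 * (norm y)\<^sup>2)" using A by (intro mult_right_mono) auto
  finally have "b\<^sup>2 / A \<le> 4 * (norm y)\<^sup>2" using A by (simp add: field_simps)
  then have mb: "real m * b\<^sup>2 / A \<le> real m * (4 * (norm y)\<^sup>2)"
    using mult_left_mono[of "b\<^sup>2 / A" "4 * (norm y)\<^sup>2" "real m"] by simp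
  have "\<kappa> + (norm (s + y))\<^sup>2 = A + b" "\<kappa> + (norm (s - y))\<^sup>2 = A - b"
    by (simp_all add: A_def W_def b_def power2_norm_eq_inner algebra_simps inner_commute)
  then have "((\<kappa> + (norm (s + y))\<^sup>2) ^ m + (\<kappa> + (norm (s - y))\<^sup>2) ^ m) / 2
      \<le> (A + real m * b\<^sup>2 / A) ^ m" using symmetric_power_le[OF A(1) bA] by simp
  also have "\<dots> \<le> (W + (4 * real m + 1) * (norm y)\<^sup>2) ^ m"
  proof (rule power_mono)
    show "A + real m * b\<^sup>2 / A \<le> W + (4 * real m + 1) * (norm y)\<^sup>2"
      using mb by (simp add: A_def algebra_simps)
  qed (use A in simp)
  also have "\<dots> \<le> (W * (1 + (4 * real m + 1) * (norm y)\<^sup>2 / \<kappa>)) ^ m"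
  proof (rule power_mono)
    have "(4 * real m + 1) * (norm y)\<^sup>2 \<le> W * ((4 * real m + 1) * (norm y)\<^sup>2 / \<kappa>)"
      using mult_right_mono[OF W, of "(4 * real m + 1) * (norm y)\<^sup>2"] \<kappa> by (simp add: field_simps)
    then show "W + (4 * real m + 1) * (norm y)\<^sup>2 \<le> W * (1 + (4 * real m + 1) * (norm y)\<^sup>2 / \<kappa>)"
      by (simp add: distrib_left)
  qed (use W \<kappa> in auto)
  also have "\<dots> = W ^ m * (1 + (4 * real m + 1) * (norm y)\<^sup>2 / \<kappa>) ^ m" by (rule power_mult_distrib)
  also have "\<dots> \<le> W ^ m * (1 + (1 + (4 * real m + 1) * (norm y)\<^sup>2) ^ m / \<kappa>)"
  proof (rule mult_left_mono)
    have "(1 + (4 * real m + 1) * (norm y)\<^sup>2 / \<kappa>) ^ m \<le> 1 + ((1 + (4 * real m + 1) * (norm y)\<^sup>2) ^ m - 1) / \<kappa>"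
      using \<kappa> by (intro power_one_add_divide_le) auto
    also have "\<dots> \<le> 1 + (1 + (4 * real m + 1) * (norm y)\<^sup>2) ^ m / \<kappa>"
      using \<kappa> by (intro add_left_mono divide_right_mono) auto
    finally show "(1 + (4 * real m + 1) * (norm y)\<^sup>2 / \<kappa>) ^ m \<le> 1 + (1 + (4 * real m + 1) * (norm y)\<^sup>2) ^ m / \<kappa>" .
  qed (use W \<kappa> in auto)
  finally show ?thesis by (simp add: W_def)
qed

text \<open>As \<open>f\<close> is even, the integral equals its mean with the reflected one, and
  the pointwise bound for the pair \<open>s + y\<close>, \<open>s - y\<close> applies. Later
  \<kappa> is the number of factors, which keeps the product of all \<open>1 + D / \<kappa>\<close>
  bounded.\<close>

lemma nn_integral_symmetric_moment_le:
  fixes f :: "'a::euclidean_space \<Rightarrow> ennreal" and \<kappa> D :: real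
  assumes [measurable]: "f \<in> borel_measurable borel" and even: "\<And>x. f (- x) = f x"
    and int: "(\<integral>\<^sup>+x. f x \<partial>lborel) = 1" and \<kappa>: "\<kappa> \<ge> 1" and D: "D \<ge> 0"
    and mom: "(\<integral>\<^sup>+x. ennreal ((1 + (4 * real m + 1) * (norm x)\<^sup>2) ^ m) * f x \<partial>lborel) \<le> ennreal D"
  shows "(\<integral>\<^sup>+y. ennreal ((\<kappa> + (norm (s + y))\<^sup>2) ^ m) * f y \<partial>lborel)
    \<le> ennreal ((\<kappa> + (norm s)\<^sup>2) ^ m) * ennreal (1 + D / \<kappa>)"
proof -
  let ?g = "\<lambda>y. ennreal ((\<kappa> + (norm (s + y))\<^sup>2) ^ m)" and ?q = "\<lambda>y::'a. (1 + (4 * real m + 1) * (norm y)\<^sup>2) ^ m"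
  let ?I = "\<integral>\<^sup>+y. ?g y * f y \<partial>lborel" and ?w = "(\<kappa> + (norm s)\<^sup>2) ^ m"
  have reflect: "?I = (\<integral>\<^sup>+y. ?g (- y) * f y \<partial>lborel)"
    using nn_integral_lborel_uminus[of "\<lambda>y. ?g y * f y"] even by simp
  have "?I = ennreal (1/2) * (?I + ?I)"
  proof -
    have "ennreal (1/2) * 2 = 1" using ennreal_mult[of "1/2" 2] by simp
    then show ?thesis by (simp only: mult_2[symmetric] mult.assoc[symmetric] mult_1_left)
  qed
  also have "?I + ?I = (\<integral>\<^sup>+y. ?g y * f y + ?g (- y) * f y \<partial>lborel)"
  proof -
    have "?I + ?I = ?I + (\<integral>\<^sup>+y. ?g (- y) * f y \<partial>lborel)" by (simp only: reflect[symmetric])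
    also have "\<dots> = (\<integral>\<^sup>+y. ?g y * f y + ?g (- y) * f y \<partial>lborel)"
      by (rule nn_integral_add[symmetric]) measurable
    finally show ?thesis .
  qed
  also have "ennreal (1/2) * \<dots> = (\<integral>\<^sup>+y. ennreal (1/2) * (?g y * f y + ?g (- y) * f y) \<partial>lborel)"
    by (rule nn_integral_cmult[symmetric]) measurable
  also have "\<dots> \<le> (\<integral>\<^sup>+y. ennreal ?w * (f y + ennreal (1 / \<kappa>) * (ennreal (?q y) * f y)) \<partial>lborel)"
  proof (rule nn_integral_mono)
    fix y
    have "ennreal (1/2) * (?g y * f y + ?g (- y) * f y) = ennreal (1/2) * (?g y + ?g (- y)) * f y"
      by (simp add: distrib_right mult.assoc)
    also have "ennreal (1/2) * (?g y + ?g (- y))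
        = ennreal (((\<kappa> + (norm (s + y))\<^sup>2) ^ m + (\<kappa> + (norm (s - y))\<^sup>2) ^ m) / 2)"
    proof -
      have "ennreal (1/2) * (ennreal a + ennreal b) = ennreal ((a + b) / 2)" if "a \<ge> 0" "b \<ge> 0" for a b
        using that ennreal_mult[of "1/2" "a + b"] ennreal_plus[of a b] by simp
      then show ?thesis using \<kappa> by simp
    qed
    also have "\<dots> \<le> ennreal (?w * (1 + ?q y / \<kappa>))"
      by (intro ennreal_leI symmetric_norm_power_le \<kappa>)
    also have "\<dots> = ennreal ?w * (1 + ennreal (1 / \<kappa>) * ennreal (?q y))"
      using \<kappa> by (subst ennreal_mult) (auto simp: ennreal_plus ennreal_mult[symmetric])
    finally show "ennreal (1/2) * (?g y * f y + ?g (- y) * f y)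
        \<le> ennreal ?w * (f y + ennreal (1 / \<kappa>) * (ennreal (?q y) * f y))"
      by (simp add: distrib_right mult.assoc mult_right_mono)
  qed
  also have "\<dots> = ennreal ?w * (1 + ennreal (1 / \<kappa>) * (\<integral>\<^sup>+y. ennreal (?q y) * f y \<partial>lborel))"
    by (simp add: nn_integral_cmult nn_integral_add int)
  also have "\<dots> \<le> ennreal ?w * (1 + ennreal (1 / \<kappa>) * ennreal D)"
    by (intro mult_left_mono add_left_mono mom) auto
  also have "\<dots> = ennreal ?w * ennreal (1 + D / \<kappa>)"
    using \<kappa> D by (simp add: ennreal_plus ennreal_mult[symmetric])
  finally show ?thesis .
qed

lemma nn_integral_nnconv_pow_moment_le:
  fixes f :: "'a::euclidean_space \<Rightarrow> ennreal" and \<kappa> D :: real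
  assumes [measurable]: "f \<in> borel_measurable borel" and even: "\<And>x. f (- x) = f x"
    and int: "(\<integral>\<^sup>+x. f x \<partial>lborel) = 1" and \<kappa>: "\<kappa> \<ge> 1" and D: "D \<ge> 0"
    and mom: "(\<integral>\<^sup>+x. ennreal ((1 + (4 * real m + 1) * (norm x)\<^sup>2) ^ m) * f x \<partial>lborel) \<le> ennreal D"
  shows "(\<integral>\<^sup>+x. ennreal ((\<kappa> + (norm x)\<^sup>2) ^ m) * nnconv_pow f k x \<partial>lborel)
    \<le> ennreal (\<kappa> ^ m * (1 + D / \<kappa>) ^ Suc k)"
proof (induction k)
  case 0
  show ?case
    using nn_integral_symmetric_moment_le[OF assms, of 0] \<kappa> D
    by (simp add: ennreal_mult[symmetric] del: ennreal_plus)
next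
  case (Suc k)
  have "(\<integral>\<^sup>+x. ennreal ((\<kappa> + (norm x)\<^sup>2) ^ m) * nnconv_pow f (Suc k) x \<partial>lborel)
      = (\<integral>\<^sup>+z. nnconv_pow f k z * (\<integral>\<^sup>+y. ennreal ((\<kappa> + (norm (z + y))\<^sup>2) ^ m) * f y \<partial>lborel) \<partial>lborel)"
    unfolding nnconv_seq.simps by (rule nn_integral_nnconv_weighted) measurable
  also have "\<dots> \<le> (\<integral>\<^sup>+z. nnconv_pow f k z * (ennreal ((\<kappa> + (norm z)\<^sup>2) ^ m) * ennreal (1 + D / \<kappa>)) \<partial>lborel)"
    by (intro nn_integral_mono mult_left_mono nn_integral_symmetric_moment_le assms) auto
  also have "\<dots> = ennreal (1 + D / \<kappa>) * (\<integral>\<^sup>+z. ennreal ((\<kappa> + (norm z)\<^sup>2) ^ m) * nnconv_pow f k z \<partial>lborel)"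
    by (subst nn_integral_cmult[symmetric]) (auto simp: mult_ac)
  also have "\<dots> \<le> ennreal (1 + D / \<kappa>) * ennreal (\<kappa> ^ m * (1 + D / \<kappa>) ^ Suc k)"
    by (intro mult_left_mono Suc.IH) auto
  also have "\<dots> = ennreal (\<kappa> ^ m * (1 + D / \<kappa>) ^ Suc (Suc k))"
    using \<kappa> D by (simp add: ennreal_mult[symmetric] mult_ac del: ennreal_plus)
  finally show ?case .
qed

section \<open>Weighted Young inequality\<close>

lemma nnconv_seq_cong:
  assumes "\<And>i. i \<le> k \<Longrightarrow> a i = b i"
  shows "nnconv_seq a k = nnconv_seq b k"
  using assms by (induction k) auto

text \<open>A convolution is an integral of the products \<open>\<Prod>i. a i (y i)\<close> over \<open>\<Sum>i. y i = x\<close>, so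
  inequalities between such products integrate.\<close>

lemma nnconv_seq_le_sum:
  fixes a :: "nat \<Rightarrow> 'a::euclidean_space \<Rightarrow> ennreal"
  assumes [measurable]: "\<And>i. a i \<in> borel_measurable borel" "\<And>s i. b s i \<in> borel_measurable borel"
    and le: "\<And>y. A * (\<Prod>i\<le>k. a i (y i)) \<le> (\<Sum>s\<in>S. w s * (\<Prod>i\<le>k. b s i (y i)))"
  shows "A * nnconv_seq a k x \<le> (\<Sum>s\<in>S. w s * nnconv_seq (b s) k x)"
  using le
proof (induction k arbitrary: x A w)
  case 0
  from 0[of "\<lambda>_. x"] show ?case by simp
next
  case (Suc k)
  have "A * nnconv_seq a (Suc k) x = (\<integral>\<^sup>+y. (A * a (Suc k) y) * nnconv_seq a k (x - y) \<partial>lborel)"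
    by (simp add: nnconv_def nn_integral_cmult[symmetric] mult_ac)
  also have "\<dots> \<le> (\<integral>\<^sup>+y. (\<Sum>s\<in>S. (w s * b s (Suc k) y) * nnconv_seq (b s) k (x - y)) \<partial>lborel)"
  \<comment> \<open>With the last variable frozen, its factors move into the constants
    \<open>A\<close> and \<open>w s\<close>; the induction generalises over both for this
    purpose.\<close>
  proof (rule nn_integral_mono, rule Suc.IH)
    fix y z
    have "(\<Prod>i\<le>k. c i ((z(Suc k := y)) i)) = (\<Prod>i\<le>k. c i (z i))" for c :: "nat \<Rightarrow> 'a \<Rightarrow> ennreal"
      by (intro prod.cong) auto
    note upd = this
    from Suc.prems[of "z(Suc k := y)"]
    have "A * ((\<Prod>i\<le>k. a i (z i)) * a (Suc k) y)
       \<le> (\<Sum>s\<in>S. w s * ((\<Prod>i\<le>k. b s i (z i)) * b s (Suc k) y))"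
      by (simp only: prod.atMost_Suc upd fun_upd_same)
    then show "A * a (Suc k) y * (\<Prod>i\<le>k. a i (z i)) \<le> (\<Sum>s\<in>S. w s * b s (Suc k) y * (\<Prod>i\<le>k. b s i (z i)))"
      by (simp only: mult_ac)
  qed
  also have "\<dots> = (\<Sum>s\<in>S. \<integral>\<^sup>+y. w s * (nnconv_seq (b s) k (x - y) * b s (Suc k) y) \<partial>lborel)"
    by (subst nn_integral_sum) (auto simp: mult_ac)
  also have "\<dots> = (\<Sum>s\<in>S. w s * nnconv_seq (b s) (Suc k) x)"
    by (simp add: nnconv_def nn_integral_cmult)
  finally show ?case .
qed

text \<open>A constant in one slot lifts the constraint that the variables add up to
  \<open>x\<close>, leaving \<open>k\<close> independent integrals of \<open>G\<close>.\<close>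

lemma nnconv_seq_all_but_one:
  fixes G :: "'a::euclidean_space \<Rightarrow> ennreal"
  assumes [measurable]: "G \<in> borel_measurable borel" and "s \<le> k"
  shows "nnconv_seq (\<lambda>i. if i = s then (\<lambda>_. 1) else G) k x \<le> (\<integral>\<^sup>+y. G y \<partial>lborel) ^ k"
  using assms(2)
proof (induction k arbitrary: x)
  case (Suc k)
  let ?a = "\<lambda>i. if i = s then (\<lambda>_. 1) else G"
  show ?case
  proof (cases "s = Suc k")
    case True
    have "nnconv_seq ?a k = nnconv_pow G k" by (rule nnconv_seq_cong) (auto simp: True)
    then have "nnconv_seq ?a (Suc k) x = (\<integral>\<^sup>+y. nnconv_pow G k (x - y) \<partial>lborel)"
      by (simp add: True nnconv_def)
    also have "\<dots> = (\<integral>\<^sup>+y. G y \<partial>lborel) ^ Suc k"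
      by (simp add: nn_integral_lborel_diff nn_integral_nnconv_pow)
    finally show ?thesis by simp
  next
    case False
    then have "s \<le> k" using Suc.prems by simp
    then have "nnconv (nnconv_seq ?a k) G x \<le> (\<integral>\<^sup>+y. G y \<partial>lborel) ^ k * (\<integral>\<^sup>+y. G y \<partial>lborel)"
      by (intro nnconv_le_bound Suc.IH) auto
    then show ?thesis using False by (simp add: mult.commute)
  qed
qed simp

text \<open>The index of the least number varies with the point. Summing over all candidates
  \<open>s\<close> yields a fixed list of products, which can be integrated one by one.\<close>

lemma prod_le_sum_prod_powr:
  fixes v :: "nat \<Rightarrow> real"
  assumes v: "\<And>i. v i \<ge> 0" and k: "k \<ge> 1"
  shows "(\<Prod>i\<le>k. v i) \<le> (\<Sum>s\<le>k. \<Prod>i\<le>k. if i = s then 1 else v i powr (1 + 1 / k))"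
proof -
  obtain s where s: "s \<le> k" "\<And>i. i \<le> k \<Longrightarrow> v s \<le> v i"
  proof -
    have "Min (v ` {..k}) \<in> v ` {..k}" by (intro Min_in) auto
    then obtain s where "Min (v ` {..k}) = v s" "s \<in> {..k}" by (rule imageE)
    moreover have "Min (v ` {..k}) \<le> v i" if "i \<le> k" for i using that by (intro Min_le) auto
    ultimately show ?thesis using that[of s] by simp
  qed
  have root: "(v s powr (1 / k)) ^ k = v s"
  proof (cases "v s = 0")
    case False
    then have "v s > 0" using v[of s] by simp
    then show ?thesis using k by (simp add: powr_realpow[symmetric] powr_powr)
  qed (use k in simp)
  have "v s = (\<Prod>i\<in>{..k} - {s}. v s powr (1 / k))"
    using s root by simp
  also have "\<dots> \<le> (\<Prod>i\<in>{..k} - {s}. v i powr (1 / k))"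
    using s v by (intro prod_mono) (auto intro!: powr_mono2)
  finally have vs: "v s \<le> (\<Prod>i\<in>{..k} - {s}. v i powr (1 / k))" .
  have "(\<Prod>i\<le>k. v i) = v s * (\<Prod>i\<in>{..k} - {s}. v i)"
    using s by (intro prod.remove) auto
  also have "\<dots> \<le> (\<Prod>i\<in>{..k} - {s}. v i powr (1 / k)) * (\<Prod>i\<in>{..k} - {s}. v i)"
    using v by (intro mult_right_mono vs prod_nonneg) auto
  also have "\<dots> = (\<Prod>i\<in>{..k} - {s}. v i powr (1 + 1 / k))"
    unfolding prod.distrib[symmetric] using v by (intro prod.cong) (auto simp: powr_add mult.commute)
  also have "\<dots> = (\<Prod>i\<le>k. if i = s then 1 else v i powr (1 + 1 / k))"
    using s by (subst (2) prod.remove[of _ s]) (auto intro!: prod.cong)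
  also have "\<dots> \<le> (\<Sum>s\<le>k. \<Prod>i\<le>k. if i = s then 1 else v i powr (1 + 1 / k))"
    using s v by (intro member_le_sum[of s]) (auto intro!: prod_nonneg)
  finally show ?thesis .
qed

text \<open>\<open>1 + 1 / k\<close> is the exponent for which Young's inequality makes a
  convolution of k + 1 factors bounded. The factor \<open>Suc k\<close> comes from summing over the
  candidates and is harmless, since the bound is applied to a finite range of
  \<open>k\<close>.\<close>

lemma nnconv_pow_young:
  fixes F :: "'a::euclidean_space \<Rightarrow> real"
  assumes [measurable]: "F \<in> borel_measurable borel" and F: "\<And>x. F x \<ge> 0" and k: "k \<ge> 1"
  shows "nnconv_pow (\<lambda>x. ennreal (F x)) k x
    \<le> of_nat (Suc k) * (\<integral>\<^sup>+y. ennreal (F y powr (1 + 1 / k)) \<partial>lborel) ^ k"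
proof -
  let ?G = "\<lambda>y. ennreal (F y powr (1 + 1 / k))"
  let ?b = "\<lambda>s i. if i = s then (\<lambda>_. 1) else ?G"
  have pointwise: "(\<Prod>i\<le>k. ennreal (F (y i))) \<le> (\<Sum>s\<le>k. \<Prod>i\<le>k. ?b s i (y i))" for y
  proof -
    have "(\<Prod>i\<le>k. ennreal (F (y i))) = ennreal (\<Prod>i\<le>k. F (y i))"
      by (rule prod_ennreal) (simp add: F)
    also have "\<dots> \<le> ennreal (\<Sum>s\<le>k. \<Prod>i\<le>k. if i = s then 1 else F (y i) powr (1 + 1 / k))"
      by (intro ennreal_leI prod_le_sum_prod_powr F k)
    also have "\<dots> = (\<Sum>s\<le>k. ennreal (\<Prod>i\<le>k. if i = s then 1 else F (y i) powr (1 + 1 / k)))"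
      by (rule sum_ennreal[symmetric]) (auto intro!: prod_nonneg)
    also have "\<dots> = (\<Sum>s\<le>k. \<Prod>i\<le>k. ennreal (if i = s then 1 else F (y i) powr (1 + 1 / k)))"
      by (intro sum.cong refl prod_ennreal[symmetric]) auto
    also have "\<dots> = (\<Sum>s\<le>k. \<Prod>i\<le>k. ?b s i (y i))"
      by (intro sum.cong prod.cong refl) auto
    finally show ?thesis .
  qed
  have "1 * nnconv_pow (\<lambda>x. ennreal (F x)) k x \<le> (\<Sum>s\<le>k. 1 * nnconv_seq (?b s) k x)"
    using pointwise by (intro nnconv_seq_le_sum) auto
  also have "\<dots> \<le> (\<Sum>s\<le>k. (\<integral>\<^sup>+y. ?G y \<partial>lborel) ^ k)"
    unfolding mult_1_left by (intro sum_mono nnconv_seq_all_but_one) auto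
  finally show ?thesis by simp
qed

section \<open>Polynomial weights under convolution\<close>

lemma jbracket_ge_1: "jbracket x \<ge> 1"
  by (simp add: jbracket_def)

lemma jbracket_pos: "jbracket x > 0"
  using jbracket_ge_1[of x] by linarith

lemma jbracket_mult_le:
  fixes x y :: "'a::real_normed_vector"
  shows "jbracket x \<le> 2 * jbracket (x - y) * jbracket y"
proof -
  have "(norm x)\<^sup>2 \<le> (norm (x - y) + norm y)\<^sup>2"
    using norm_triangle_ineq[of "x - y" y] by (intro power_mono) auto
  also have "\<dots> \<le> 2 * (norm (x - y))\<^sup>2 + 2 * (norm y)\<^sup>2"
    using sum_squares_bound[of "norm (x - y)" "norm y"] by (simp add: power2_sum)
  finally have "1 + (norm x)\<^sup>2 \<le> 4 * ((1 + (norm (x - y))\<^sup>2) * (1 + (norm y)\<^sup>2))"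
    by (simp add: algebra_simps add_nonneg_nonneg) (smt (verit) zero_le_power2 mult_nonneg_nonneg)
  then have "sqrt (1 + (norm x)\<^sup>2) \<le> sqrt (4 * ((1 + (norm (x - y))\<^sup>2) * (1 + (norm y)\<^sup>2)))"
    by (rule real_sqrt_le_mono)
  then show ?thesis by (simp add: jbracket_def real_sqrt_mult)
qed

lemma borel_measurable_jbracket [measurable]: "jbracket \<in> borel_measurable borel"
  unfolding jbracket_def[abs_def] by measurable

text \<open>The Peetre-type inequality \<open>jbracket_mult_le\<close> distributes the weight over
  all factors at the cost of \<open>2 powr \<beta>\<close> per convolution. This is exponential in
  \<open>k\<close>, hence fit for small \<open>k\<close> only.\<close>

lemma weighted_nnconv_pow_le:
  fixes f :: "'a::euclidean_space \<Rightarrow> ennreal"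
  assumes [measurable]: "f \<in> borel_measurable borel" and \<beta>: "\<beta> \<ge> 0"
  shows "ennreal (jbracket x powr \<beta>) * nnconv_pow f k x
    \<le> ennreal (2 powr \<beta>) ^ k * nnconv_pow (\<lambda>x. ennreal (jbracket x powr \<beta>) * f x) k x"
proof (induction k arbitrary: x)
  case (Suc k)
  let ?w = "\<lambda>x::'a. ennreal (jbracket x powr \<beta>)" and ?F = "nnconv_pow (\<lambda>x. ennreal (jbracket x powr \<beta>) * f x)"
  have w: "?w x \<le> ennreal (2 powr \<beta>) * ?w (x - y) * ?w y" for y
  proof -
    have "jbracket x powr \<beta> \<le> (2 * jbracket (x - y) * jbracket y) powr \<beta>"
      using \<beta> jbracket_pos[of x] by (intro powr_mono2 jbracket_mult_le) auto
    also have "\<dots> = 2 powr \<beta> * jbracket (x - y) powr \<beta> * jbracket y powr \<beta>"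
      using jbracket_pos[of y] jbracket_pos[of "x - y"] by (simp add: powr_mult)
    finally show ?thesis by (simp add: ennreal_mult[symmetric])
  qed
  have "?w x * nnconv_pow f (Suc k) x = (\<integral>\<^sup>+y. ?w x * (nnconv_pow f k (x - y) * f y) \<partial>lborel)"
    by (simp add: nnconv_def nn_integral_cmult)
  also have "\<dots> \<le> (\<integral>\<^sup>+y. ennreal (2 powr \<beta>) ^ Suc k * (?F k (x - y) * (?w y * f y)) \<partial>lborel)"
  proof (rule nn_integral_mono)
    fix y
    have "?w x * (nnconv_pow f k (x - y) * f y)
        \<le> ennreal (2 powr \<beta>) * ?w (x - y) * ?w y * (nnconv_pow f k (x - y) * f y)"
      by (intro mult_right_mono w) auto
    also have "\<dots> = ennreal (2 powr \<beta>) * (?w (x - y) * nnconv_pow f k (x - y)) * (?w y * f y)"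
      by (simp only: mult_ac)
    also have "\<dots> \<le> ennreal (2 powr \<beta>) * (ennreal (2 powr \<beta>) ^ k * ?F k (x - y)) * (?w y * f y)"
      by (intro mult_right_mono mult_left_mono Suc.IH) auto
    finally show "?w x * (nnconv_pow f k (x - y) * f y)
        \<le> ennreal (2 powr \<beta>) ^ Suc k * (?F k (x - y) * (?w y * f y))"
      by (simp only: mult_ac power_Suc)
  qed
  also have "\<dots> = ennreal (2 powr \<beta>) ^ Suc k * ?F (Suc k) x"
    by (simp add: nnconv_def nn_integral_cmult del: power_Suc)
  finally show ?case .
qed simp

text \<open>The exponent needed for Young's inequality lies between 1 and
  \<open>1 + \<epsilon>\<close>, so the power of \<open>F\<close> is pointwise at most the sum of
  the two integrable ones.\<close>

lemma weighted_nnconv_pow_bounded: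
  fixes g :: "'a::euclidean_space \<Rightarrow> real"
  assumes [measurable]: "g \<in> borel_measurable borel" and g: "\<And>x. g x \<ge> 0" and \<beta>: "\<beta> \<ge> 0"
    and L1: "(\<integral>\<^sup>+x. ennreal (jbracket x powr \<beta> * g x) \<partial>lborel) < \<infinity>"
    and Lq: "(\<integral>\<^sup>+x. ennreal ((jbracket x powr \<beta> * g x) powr (1 + \<epsilon>)) \<partial>lborel) < \<infinity>"
    and k: "k \<ge> 1" "1 / k \<le> \<epsilon>"
  shows "\<exists>C\<ge>0. \<forall>x. ennreal (jbracket x powr \<beta>) * nnconv_pow (\<lambda>x. ennreal (g x)) k x \<le> ennreal C"
proof -
  define F where "F x = jbracket x powr \<beta> * g x" for x
  have [measurable]: "F \<in> borel_measurable borel" unfolding F_def[abs_def] by measurable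
  have F: "F x \<ge> 0" for x using g by (simp add: F_def)
  have "F x powr (1 + 1 / k) \<le> F x + F x powr (1 + \<epsilon>)" for x
  proof (cases "F x \<le> 1")
    case True
    then have "F x powr (1 + 1 / k) \<le> F x powr 1" using F[of x] powr_mono'[of 1 "1 + 1 / k" "F x"] by simp
    then show ?thesis using F[of x] by (simp add: add_increasing2)
  next
    case False
    then have "F x powr (1 + 1 / k) \<le> F x powr (1 + \<epsilon>)" using k by (intro powr_mono) auto
    then show ?thesis using F[of x] by linarith
  qed
  then have "(\<integral>\<^sup>+x. ennreal (F x powr (1 + 1 / k)) \<partial>lborel)
      \<le> (\<integral>\<^sup>+x. ennreal (F x) + ennreal (F x powr (1 + \<epsilon>)) \<partial>lborel)"
    using F by (intro nn_integral_mono) (simp add: ennreal_plus[symmetric] del: ennreal_plus)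
  also have "\<dots> = (\<integral>\<^sup>+x. ennreal (F x) \<partial>lborel) + (\<integral>\<^sup>+x. ennreal (F x powr (1 + \<epsilon>)) \<partial>lborel)"
    by (rule nn_integral_add) auto
  also have "\<dots> < \<infinity>" using L1 Lq by (simp add: F_def)
  finally have fin: "(\<integral>\<^sup>+x. ennreal (F x powr (1 + 1 / k)) \<partial>lborel) < top" by simp
  define B where "B = ennreal (2 powr \<beta>) ^ k * (of_nat (Suc k) * (\<integral>\<^sup>+y. ennreal (F y powr (1 + 1 / k)) \<partial>lborel) ^ k)"
  have "B < top" unfolding B_def using fin
    by (auto simp: ennreal_mult_less_top power_less_top_ennreal of_nat_less_top)
  then obtain C where C: "C \<ge> 0" "B = ennreal C" by (metis ennreal_cases less_irrefl)
  have "ennreal (jbracket x powr \<beta>) * nnconv_pow (\<lambda>x. ennreal (g x)) k x \<le> B" for x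
  proof -
    have "(\<lambda>x. ennreal (jbracket x powr \<beta>) * ennreal (g x)) = (\<lambda>x. ennreal (F x))"
      using g by (auto simp: F_def ennreal_mult)
    then show ?thesis
      using weighted_nnconv_pow_le[of "\<lambda>x. ennreal (g x)" \<beta> x k] \<beta>
        mult_left_mono[OF nnconv_pow_young[of F k x], of "ennreal (2 powr \<beta>) ^ k"] F k
      unfolding B_def by (auto intro: order_trans)
  qed
  then show ?thesis using C by auto
qed

section \<open>Local decay of convolution powers\<close>

lemma quadratic_power_split_le:
  fixes x y :: "'a::real_normed_vector" and K :: real
  assumes K: "K > 0"
  shows "(1 + (norm x)\<^sup>2 / K) ^ m \<le> 4 ^ m * ((1 + (norm (x - y))\<^sup>2 / K) ^ m + (1 + (norm y)\<^sup>2 / K) ^ m)"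
proof -
  define a b where "a = 1 + (norm (x - y))\<^sup>2 / K" and "b = 1 + (norm y)\<^sup>2 / K"
  have ab: "a \<ge> 1" "b \<ge> 1" using K by (auto simp: a_def b_def)
  have "(norm x)\<^sup>2 \<le> (norm (x - y) + norm y)\<^sup>2"
    using norm_triangle_ineq[of "x - y" y] by (intro power_mono) auto
  also have "\<dots> \<le> 2 * (norm (x - y))\<^sup>2 + 2 * (norm y)\<^sup>2"
    using sum_squares_bound[of "norm (x - y)" "norm y"] by (simp add: power2_sum)
  finally have "(norm x)\<^sup>2 / K \<le> (2 * (norm (x - y))\<^sup>2 + 2 * (norm y)\<^sup>2) / K"
    using K by (intro divide_right_mono) auto
  then have "1 + (norm x)\<^sup>2 / K \<le> 2 * a + 2 * b"
    by (simp add: a_def b_def add_divide_distrib)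
  also have "\<dots> \<le> 4 * max a b" by simp
  finally have "(1 + (norm x)\<^sup>2 / K) ^ m \<le> (4 * max a b) ^ m" using K by (intro power_mono) auto
  also have "\<dots> = 4 ^ m * max a b ^ m" by (rule power_mult_distrib)
  also have "max a b ^ m \<le> a ^ m + b ^ m" using ab by (auto simp: max_def)
  finally show ?thesis by (simp add: a_def b_def)
qed

text \<open>With \<open>\<kappa> = Suc k\<close> there are at most \<open>Suc k\<close> factors
  \<open>1 + D / \<kappa>\<close>, whose product is at most \<open>exp D\<close>, uniformly in
  \<open>i\<close> and \<open>k\<close>.\<close>

lemma nn_integral_scaled_moment_le:
  fixes f :: "'a::euclidean_space \<Rightarrow> ennreal" and D :: real
  assumes [measurable]: "f \<in> borel_measurable borel" and even: "\<And>x. f (- x) = f x"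
    and int: "(\<integral>\<^sup>+x. f x \<partial>lborel) = 1" and D: "D \<ge> 0"
    and mom: "(\<integral>\<^sup>+x. ennreal ((1 + (4 * real m + 1) * (norm x)\<^sup>2) ^ m) * f x \<partial>lborel) \<le> ennreal D"
    and ik: "i \<le> k"
  shows "(\<integral>\<^sup>+x. ennreal ((1 + (norm x)\<^sup>2 / Suc k) ^ m) * nnconv_pow f i x \<partial>lborel) \<le> ennreal (exp D)"
proof -
  let ?K = "real (Suc k)"
  have eq: "ennreal ((1 + (norm x)\<^sup>2 / ?K) ^ m) = ennreal (1 / ?K ^ m) * ennreal ((?K + (norm x)\<^sup>2) ^ m)" for x :: 'a
  proof -
    have "1 + (norm x)\<^sup>2 / ?K = (?K + (norm x)\<^sup>2) / ?K" by (simp add: add_divide_distrib)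
    then show ?thesis by (simp add: ennreal_mult[symmetric] power_divide)
  qed
  have "(\<integral>\<^sup>+x. ennreal ((1 + (norm x)\<^sup>2 / ?K) ^ m) * nnconv_pow f i x \<partial>lborel)
      = ennreal (1 / ?K ^ m) * (\<integral>\<^sup>+x. ennreal ((?K + (norm x)\<^sup>2) ^ m) * nnconv_pow f i x \<partial>lborel)"
    unfolding eq by (subst nn_integral_cmult[symmetric]) (auto simp: mult.assoc)
  also have "\<dots> \<le> ennreal (1 / ?K ^ m) * ennreal (?K ^ m * (1 + D / ?K) ^ Suc i)"
    by (intro mult_left_mono nn_integral_nnconv_pow_moment_le assms) auto
  also have "\<dots> = ennreal ((1 + D / ?K) ^ Suc i)"
    using D by (simp add: ennreal_mult[symmetric] del: of_nat_Suc power_Suc ennreal_plus)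
  also have "\<dots> \<le> ennreal (exp D)"
  proof (rule ennreal_leI)
    have "(1 + D / ?K) ^ Suc i \<le> exp (D / ?K) ^ Suc i"
      using D by (intro power_mono exp_ge_add_one_self) (auto intro!: add_nonneg_nonneg)
    also have "\<dots> = exp (Suc i * (D / ?K))" by (rule exp_of_nat_mult[symmetric])
    also have "Suc i * (D / ?K) \<le> D"
      using ik D by (simp add: field_simps mult_left_mono)
    finally show "(1 + D / ?K) ^ Suc i \<le> exp D" by simp
  qed
  finally show ?thesis .
qed

lemma nnconv_weighted_split_le:
  fixes a b :: "'a::euclidean_space \<Rightarrow> ennreal" and W :: "'a \<Rightarrow> ennreal"
  assumes [measurable]: "a \<in> borel_measurable borel" "b \<in> borel_measurable borel" "W \<in> borel_measurable borel"
    and W: "\<And>y. W x \<le> c * (W (x - y) + W y)"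
    and a: "\<And>x. a x \<le> A" and b: "\<And>x. b x \<le> B"
  shows "W x * nnconv a b x
    \<le> c * (B * (\<integral>\<^sup>+y. W y * a y \<partial>lborel) + A * (\<integral>\<^sup>+y. W y * b y \<partial>lborel))"
proof -
  have "W x * nnconv a b x = (\<integral>\<^sup>+y. W x * (a (x - y) * b y) \<partial>lborel)"
    by (simp add: nnconv_def nn_integral_cmult)
  also have "\<dots> \<le> (\<integral>\<^sup>+y. c * (B * (W (x - y) * a (x - y)) + A * (W y * b y)) \<partial>lborel)"
  proof (rule nn_integral_mono)
    fix y
    have "W x * (a (x - y) * b y) \<le> c * (W (x - y) + W y) * (a (x - y) * b y)"
      by (intro mult_right_mono W) auto
    also have "\<dots> = c * (b y * (W (x - y) * a (x - y)) + a (x - y) * (W y * b y))"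
      by (simp only: distrib_left distrib_right mult_ac)
    also have "\<dots> \<le> c * (B * (W (x - y) * a (x - y)) + A * (W y * b y))"
      by (intro mult_left_mono add_mono mult_right_mono a b) auto
    finally show "W x * (a (x - y) * b y) \<le> c * (B * (W (x - y) * a (x - y)) + A * (W y * b y))" .
  qed
  also have "\<dots> = c * (B * (\<integral>\<^sup>+y. W (x - y) * a (x - y) \<partial>lborel) + A * (\<integral>\<^sup>+y. W y * b y \<partial>lborel))"
    by (simp add: nn_integral_cmult nn_integral_add)
  also have "(\<integral>\<^sup>+y. W (x - y) * a (x - y) \<partial>lborel) = (\<integral>\<^sup>+y. W y * a y \<partial>lborel)"
    by (rule nn_integral_lborel_diff[of "\<lambda>y. W y * a y"]) measurable
  finally show ?thesis .
qed

text \<open>The weight lives on the diffusive scale, |x|^2 against the number of factors. Because of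
  the index shift, \<open>N\<close> is one less than the number of factors, and
  \<open>real N \<ge> 1 / \<epsilon>\<close> is what Young's inequality asks for.\<close>

lemma nnconv_pow_local_decay:
  fixes g :: "'a::euclidean_space \<Rightarrow> real"
  assumes [measurable]: "g \<in> borel_measurable borel" and g: "\<And>x. g x \<ge> 0" and even: "\<And>x. g (- x) = g x"
    and int: "(\<integral>\<^sup>+x. ennreal (g x) \<partial>lborel) = 1" and \<beta>: "\<beta> \<ge> 0" and \<epsilon>: "\<epsilon> > 0"
    and L1: "(\<integral>\<^sup>+x. ennreal (jbracket x powr (2 + \<beta>) * g x) \<partial>lborel) < \<infinity>"
    and Lq: "(\<integral>\<^sup>+x. ennreal ((jbracket x powr \<beta> * g x) powr (1 + \<epsilon>)) \<partial>lborel) < \<infinity>"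
    and N: "real N \<ge> 1 / \<epsilon>"
  shows "\<exists>C\<ge>0. \<forall>k\<ge>N. \<forall>x. ennreal ((1 + (norm x)\<^sup>2 / Suc k) powr (\<beta> / 2)) * nnconv_pow (\<lambda>x. ennreal (g x)) k x
    \<le> ennreal (C * (Suc k) powr (- real DIM('a) / 2))"
proof -
  define f where "f = (\<lambda>x. ennreal (g x))"
  define p where "p = real DIM('a) / 2"
  have p: "p > 0" by (simp add: p_def)
  have [measurable]: "f \<in> borel_measurable borel" unfolding f_def by measurable
  have N1: "N \<ge> 1" using N \<epsilon> by (cases N) (auto simp: divide_le_0_iff)
  have f_even: "f (- x) = f x" for x by (simp add: f_def even)
  have f_int: "(\<integral>\<^sup>+x. f x \<partial>lborel) = 1" by (simp add: f_def int)
  have L1': "(\<integral>\<^sup>+x. ennreal (jbracket x powr \<beta> * g x) \<partial>lborel) < \<infinity>"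
  proof -
    have "(\<integral>\<^sup>+x. ennreal (jbracket x powr \<beta> * g x) \<partial>lborel) \<le> (\<integral>\<^sup>+x. ennreal (jbracket x powr (2 + \<beta>) * g x) \<partial>lborel)"
      using jbracket_ge_1 g by (intro nn_integral_mono ennreal_leI mult_right_mono powr_mono) auto
    then show ?thesis using L1 by (rule order_le_less_trans)
  qed
  have "\<exists>C\<ge>0. \<forall>x. ennreal (jbracket x powr \<beta>) * nnconv_pow f k x \<le> ennreal C" if "k \<ge> N" for k
    unfolding f_def using that N1 N \<epsilon>
    by (intro weighted_nnconv_pow_bounded[OF _ g \<beta> L1' Lq])
      (auto simp: field_simps intro: order_trans[of _ "\<epsilon> * real N"])
  then obtain Y where Y: "\<And>k. k \<ge> N \<Longrightarrow> Y k \<ge> 0"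
    "\<And>k x. k \<ge> N \<Longrightarrow> ennreal (jbracket x powr \<beta>) * nnconv_pow f k x \<le> ennreal (Y k)" by metis
  have "nnconv_pow f N x \<le> ennreal (Y N)" for x
  proof -
    have "1 * nnconv_pow f N x \<le> ennreal (jbracket x powr \<beta>) * nnconv_pow f N x"
      using jbracket_ge_1[of x] \<beta> by (intro mult_right_mono) (auto simp: ge_one_powr_ge_zero)
    then show ?thesis using Y(2)[of N x] by simp
  qed
  then obtain S where S: "S \<ge> 0" "\<And>k x. k \<ge> N \<Longrightarrow> nnconv_pow f k x \<le> ennreal (S * (Suc k) powr - p)"
    using nnconv_pow_sup_decay[of f N "Y N"] f_even f_int unfolding p_def by auto
  define m where "m = nat \<lceil>\<beta> / 2\<rceil>"
  have m: "\<beta> / 2 \<le> real m" "real m < \<beta> / 2 + 1" using \<beta> by (auto simp: m_def) linarith+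
  have mom: "(\<integral>\<^sup>+x. ennreal ((1 + (4 * real m + 1) * (norm x)\<^sup>2) ^ m) * f x \<partial>lborel) < \<infinity>"
  proof -
    have "(1 + (4 * real m + 1) * (norm x)\<^sup>2) ^ m \<le> (4 * real m + 1) ^ m * jbracket x powr (2 + \<beta>)" for x :: 'a
    proof -
      have "(1 + (4 * real m + 1) * (norm x)\<^sup>2) ^ m \<le> ((4 * real m + 1) * (jbracket x)\<^sup>2) ^ m"
        by (intro power_mono) (auto simp: jbracket_def algebra_simps)
      also have "\<dots> = (4 * real m + 1) ^ m * jbracket x powr (2 * real m)"
        using powr_realpow[OF jbracket_pos[of x], of "2 * m"] by (simp add: power_mult_distrib power_mult)
      also have "\<dots> \<le> (4 * real m + 1) ^ m * jbracket x powr (2 + \<beta>)"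
        using m jbracket_ge_1[of x] by (intro mult_left_mono powr_mono) auto
      finally show ?thesis .
    qed
    then have "(\<integral>\<^sup>+x. ennreal ((1 + (4 * real m + 1) * (norm x)\<^sup>2) ^ m) * f x \<partial>lborel)
        \<le> (\<integral>\<^sup>+x. ennreal ((4 * real m + 1) ^ m) * ennreal (jbracket x powr (2 + \<beta>) * g x) \<partial>lborel)"
      using g unfolding f_def
      by (intro nn_integral_mono) (auto simp: ennreal_mult[symmetric] mult.assoc[symmetric] simp del: ennreal_plus intro!: ennreal_leI mult_right_mono)
    also have "\<dots> = ennreal ((4 * real m + 1) ^ m) * (\<integral>\<^sup>+x. ennreal (jbracket x powr (2 + \<beta>) * g x) \<partial>lborel)"
      by (rule nn_integral_cmult) measurable
    also have "\<dots> < \<infinity>" using L1 by (simp add: ennreal_mult_less_top)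
    finally show ?thesis .
  qed
  then obtain D where D: "D \<ge> 0"
    "(\<integral>\<^sup>+x. ennreal ((1 + (4 * real m + 1) * (norm x)\<^sup>2) ^ m) * f x \<partial>lborel) = ennreal D"
    unfolding infinity_ennreal_def less_top_ennreal by blast
  \<comment> \<open>In \<open>C1\<close>: \<open>4 ^ m\<close> from splitting the weight, 2 for the
    two halves, \<open>S * 4 powr p\<close> from the supremum of one half, \<open>exp D\<close> from
    the moment of the other. In \<open>C2\<close>, the power of \<open>2 * N + 1\<close> undoes the
    decay over the finite range.\<close>
  define C1 where "C1 = 4 ^ m * (2 * (S * 4 powr p * exp D))"
  define C2 where "C2 = (\<Sum>k\<in>{N..2*N}. Y k) * real (2 * N + 1) powr p"
  have large: "ennreal ((1 + (norm x)\<^sup>2 / Suc k) powr (\<beta> / 2)) * nnconv_pow f k x \<le> ennreal (C1 * (Suc k) powr - p)"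
    if k: "k \<ge> 2 * N + 1" for k x
  proof -
    \<comment> \<open>The indices add up to \<open>k - 1\<close> as each counts one factor less.
      Both halves reach \<open>N\<close>, so the sup bound applies to each.\<close>
    define i where "i = (k - 1) div 2"
    define j where "j = k - 1 - i"
    have ij: "k = Suc (i + j)" "i \<ge> N" "j \<ge> N" "i \<le> k" "j \<le> k" "real (Suc k) \<le> 4 * real (Suc i)" "real (Suc k) \<le> 4 * real (Suc j)"
      using k by (auto simp: i_def j_def)
    let ?W = "\<lambda>x::'a. ennreal ((1 + (norm x)\<^sup>2 / Suc k) ^ m)" and ?S = "S * 4 powr p * (Suc k) powr - p"
    have sup: "nnconv_pow f l x \<le> ennreal ?S" if l: "l \<ge> N" "real (Suc k) \<le> 4 * real (Suc l)" for l x
    proof -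
      have "real (Suc k) powr p \<le> (4 * real (Suc l)) powr p" using l p by (intro powr_mono2) auto
      also have "\<dots> = 4 powr p * real (Suc l) powr p" by (rule powr_mult)
      finally have "(Suc l) powr - p \<le> 4 powr p * (Suc k) powr - p"
        by (simp add: powr_minus_divide field_simps del: of_nat_Suc)
      then have "S * (Suc l) powr - p \<le> ?S" using S(1) by (simp only: mult.assoc mult_left_mono)
      then show ?thesis using S(2)[OF l(1), of x] by (auto intro: order_trans ennreal_leI simp del: of_nat_Suc)
    qed
    have "?W x * nnconv_pow f k x \<le> ennreal (4 ^ m) *
        (ennreal ?S * (\<integral>\<^sup>+y. ?W y * nnconv_pow f i y \<partial>lborel) + ennreal ?S * (\<integral>\<^sup>+y. ?W y * nnconv_pow f j y \<partial>lborel))"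
      unfolding ij(1) nnconv_pow_add[OF \<open>f \<in> borel_measurable borel\<close>] unfolding ij(1)[symmetric]
    proof (rule nnconv_weighted_split_le)
      fix y
      show "?W x \<le> ennreal (4 ^ m) * (?W (x - y) + ?W y)"
        using quadratic_power_split_le[of "Suc k" x m y]
        by (simp add: ennreal_plus[symmetric] ennreal_mult[symmetric] del: ennreal_plus of_nat_Suc)
    qed (use sup ij in auto)
    also have "\<dots> \<le> ennreal (4 ^ m) * (ennreal ?S * ennreal (exp D) + ennreal ?S * ennreal (exp D))"
      using D ij f_even f_int
      by (intro mult_left_mono add_mono nn_integral_scaled_moment_le) auto
    also have "\<dots> = ennreal (C1 * (Suc k) powr - p)"
      using S(1) by (simp add: ennreal_plus[symmetric] ennreal_mult[symmetric] C1_def mult_ac del: ennreal_plus of_nat_Suc)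
    finally have *: "?W x * nnconv_pow f k x \<le> ennreal (C1 * (Suc k) powr - p)" .
    \<comment> \<open>The base is at least 1, so the integer exponent dominates.\<close>
    have "(1 + (norm x)\<^sup>2 / Suc k) powr (\<beta> / 2) \<le> (1 + (norm x)\<^sup>2 / Suc k) powr m"
      using m by (intro powr_mono) auto
    also have "\<dots> = (1 + (norm x)\<^sup>2 / Suc k) ^ m" by (rule powr_realpow) (auto intro: add_pos_nonneg)
    finally have "ennreal ((1 + (norm x)\<^sup>2 / Suc k) powr (\<beta> / 2)) * nnconv_pow f k x \<le> ?W x * nnconv_pow f k x"
      by (intro mult_right_mono ennreal_leI) auto
    then show ?thesis using * by (rule order_trans)
  qed
  have small: "ennreal ((1 + (norm x)\<^sup>2 / Suc k) powr (\<beta> / 2)) * nnconv_pow f k x \<le> ennreal (C2 * (Suc k) powr - p)"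
    if k: "k \<ge> N" "k \<le> 2 * N" for k x
  proof -
    have "(1 + (norm x)\<^sup>2 / Suc k) powr (\<beta> / 2) \<le> (1 + (norm x)\<^sup>2) powr (\<beta> / 2)"
      using \<beta> divide_left_mono[of 1 "real (Suc k)" "(norm x)\<^sup>2"] by (intro powr_mono2) auto
    also have "\<dots> = jbracket x powr \<beta>"
      by (simp add: jbracket_def powr_half_sqrt[symmetric] powr_powr add_pos_nonneg)
    finally have "ennreal ((1 + (norm x)\<^sup>2 / Suc k) powr (\<beta> / 2)) * nnconv_pow f k x
        \<le> ennreal (jbracket x powr \<beta>) * nnconv_pow f k x"
      by (intro mult_right_mono ennreal_leI) auto
    also have "\<dots> \<le> ennreal (Y k)" by (rule Y(2)[OF k(1)])
    also have "\<dots> \<le> ennreal (C2 * (Suc k) powr - p)"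
    proof (rule ennreal_leI)
      have "Y k \<le> (\<Sum>k\<in>{N..2*N}. Y k)" using k Y(1) by (intro member_le_sum) auto
      moreover have "real (Suc k) powr p \<le> real (2 * N + 1) powr p" using k p by (intro powr_mono2) auto
      then have "1 \<le> real (2 * N + 1) powr p * (Suc k) powr - p"
        by (simp add: powr_minus_divide field_simps del: of_nat_Suc)
      ultimately have "Y k * 1 \<le> (\<Sum>k\<in>{N..2*N}. Y k) * (real (2 * N + 1) powr p * (Suc k) powr - p)"
        using Y(1) k by (intro mult_mono) (auto intro!: sum_nonneg)
      then show "Y k \<le> C2 * (Suc k) powr - p" by (simp add: C2_def mult.assoc)
    qed
    finally show ?thesis .
  qed
  have "C1 \<ge> 0" "C2 \<ge> 0" using S(1) Y(1) by (auto simp: C1_def C2_def intro!: mult_nonneg_nonneg sum_nonneg)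
  moreover have "ennreal ((1 + (norm x)\<^sup>2 / Suc k) powr (\<beta> / 2)) * nnconv_pow f k x
      \<le> ennreal ((C1 + C2) * (Suc k) powr - p)" if "k \<ge> N" for k x
  proof (cases "k \<le> 2 * N")
    case True
    have "C2 * (Suc k) powr - p \<le> (C1 + C2) * (Suc k) powr - p"
      using \<open>C1 \<ge> 0\<close> by (intro mult_right_mono) auto
    note le = ennreal_leI[OF this]
    from small[OF that True, of x] le show ?thesis by (rule order_trans)
  next
    case False
    have "C1 * (Suc k) powr - p \<le> (C1 + C2) * (Suc k) powr - p"
      using \<open>C2 \<ge> 0\<close> by (intro mult_right_mono) auto
    note le = ennreal_leI[OF this]
    have "2 * N + 1 \<le> k" using False by simp
    from large[OF this, of x] le show ?thesis by (rule order_trans)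
  qed
  ultimately show ?thesis unfolding f_def p_def by (intro exI[of _ "C1 + C2"]) auto
qed

section \<open>Poisson averages\<close>

lemma power_le_fact_mult_exp:
  fixes z :: real
  assumes "z \<ge> 0"
  shows "z ^ M \<le> fact M * exp z"
proof -
  have "(\<Sum>n\<in>{M}. z ^ n /\<^sub>R fact n) \<le> (\<Sum>n. z ^ n /\<^sub>R fact n)"
    using assms by (intro sum_le_suminf summable_exp_generic) auto
  then show ?thesis by (simp add: exp_def divide_simps mult.commute)
qed

text \<open>Absorbs a factor j^(-M) into the factorial, which turns a negative Poisson moment into
  the exponential series shifted by \<open>M\<close>.\<close>

lemma fact_add_le_mult_power:
  assumes "j \<ge> 1"
  shows "(fact (j + M) :: real) \<le> fact (M + 1) * real j ^ M * fact j"
proof (induction M)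
  case (Suc M)
  have "(fact (j + Suc M) :: real) = real (j + M + 1) * fact (j + M)" by simp
  also have "\<dots> \<le> (real (M + 2) * real j) * (fact (M + 1) * real j ^ M * fact j)"
  proof (intro mult_mono Suc.IH)
    have "real M * 1 \<le> real M * real j" using assms by (intro mult_left_mono) auto
    then show "real (j + M + 1) \<le> real (M + 2) * real j" using assms by (simp add: algebra_simps)
  qed auto
  also have "\<dots> = fact (Suc M + 1) * real j ^ Suc M * fact j" by (simp add: algebra_simps)
  finally show ?case .
qed simp

lemma jbracket_real_le: "t \<ge> 0 \<Longrightarrow> jbracket (t::real) \<le> 1 + t"
  unfolding jbracket_def by (intro real_le_lsqrt) (auto simp: power2_sum algebra_simps)

lemma real_le_jbracket: "(t::real) \<le> jbracket t"
  unfolding jbracket_def by (intro real_le_rsqrt) auto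

text \<open>Summed over \<open>j\<close>, this bounds the positive and negative moments of \<open>j / jbracket t\<close> under the
  Poisson law of mean \<open>\<alpha> * t\<close>, uniformly in \<open>t\<close>.\<close>

lemma poisson_moment_term_le:
  fixes \<alpha> t :: real
  assumes \<alpha>: "\<alpha> > 0" and t: "t \<ge> 0" and j: "j \<ge> 1"
  defines "\<tau> \<equiv> jbracket t"
  shows "(\<alpha> * t) ^ j / fact j * ((real j / \<tau>) ^ M + (\<tau> / real j) ^ M)
    \<le> fact M * ((\<alpha> * t * exp (1 / \<tau>)) ^ j / fact j)
      + 2 ^ M * ((\<alpha> * t) ^ j / fact j)
      + 2 ^ M * fact (M + 1) / \<alpha> ^ M * ((\<alpha> * t) ^ (j + M) / fact (j + M))"
proof -
  have \<tau>: "\<tau> \<ge> 1" "\<tau> \<le> 1 + t" using jbracket_ge_1 jbracket_real_le t by (auto simp: \<tau>_def)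
  let ?a = "(\<alpha> * t) ^ j / fact j"
  have a: "?a \<ge> 0" using \<alpha> t by simp
  \<comment> \<open>A power is traded for an exponential, which only tilts the Poisson parameter by
    \<open>exp (1 / \<tau>)\<close>.\<close>
  have "(real j / \<tau>) ^ M \<le> fact M * exp (real j * (1 / \<tau>))"
    using power_le_fact_mult_exp[of "real j / \<tau>" M] \<tau> by simp
  also have "exp (real j * (1 / \<tau>)) = exp (1 / \<tau>) ^ j" by (rule exp_of_nat_mult)
  finally have "?a * (real j / \<tau>) ^ M \<le> ?a * (fact M * exp (1 / \<tau>) ^ j)" by (intro mult_left_mono a)
  then have up: "?a * (real j / \<tau>) ^ M \<le> fact M * ((\<alpha> * t * exp (1 / \<tau>)) ^ j / fact j)"
    by (simp add: power_mult_distrib mult_ac)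
  \<comment> \<open>Splits the negative moment: the part 1 is harmless because
    \<open>j \<ge> 1\<close>, and the part \<open>t ^ M\<close> is paid for by shifting the
    index.\<close>
  have "\<tau> \<le> 2 * max 1 t" using \<tau> by linarith
  then have "\<tau> ^ M \<le> (2 * max 1 t) ^ M" using \<tau> by (intro power_mono) auto
  also have "\<dots> = 2 ^ M * max 1 t ^ M" by (rule power_mult_distrib)
  also have "\<dots> \<le> 2 ^ M * (1 + t ^ M)" using t by (intro mult_left_mono) (auto simp: max_def)
  finally have "(\<tau> / real j) ^ M \<le> 2 ^ M * (1 + t ^ M) / real j ^ M"
    by (simp add: power_divide divide_right_mono)
  also have "\<dots> = 2 ^ M * (1 / real j ^ M) + 2 ^ M * (t ^ M / real j ^ M)"
    by (simp add: distrib_left add_divide_distrib)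
  also have "\<dots> \<le> 2 ^ M * 1 + 2 ^ M * (t ^ M / real j ^ M)"
    using j by (intro add_right_mono mult_left_mono) (auto simp: one_le_power)
  finally have "?a * (\<tau> / real j) ^ M \<le> ?a * (2 ^ M * 1 + 2 ^ M * (t ^ M / real j ^ M))"
    by (intro mult_left_mono a)
  also have "\<dots> = 2 ^ M * ?a + 2 ^ M * (?a * (t ^ M / real j ^ M))"
    by (simp add: algebra_simps)
  also have "?a * (t ^ M / real j ^ M) \<le> fact (M + 1) / \<alpha> ^ M * ((\<alpha> * t) ^ (j + M) / fact (j + M))"
  proof -
    have "?a * (t ^ M / real j ^ M) = (\<alpha> * t) ^ (j + M) / \<alpha> ^ M * (1 / (real j ^ M * fact j))"
      using \<alpha> by (simp add: power_add power_mult_distrib mult_ac)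
    also have "\<dots> \<le> (\<alpha> * t) ^ (j + M) / \<alpha> ^ M * (fact (M + 1) / fact (j + M))"
      using fact_add_le_mult_power[OF j, of M] j \<alpha> t
      by (intro mult_left_mono) (auto simp: divide_simps mult_ac simp del: fact_Suc)
    finally show ?thesis by (simp add: mult_ac)
  qed
  finally have "?a * (\<tau> / real j) ^ M \<le> 2 ^ M * ?a
      + 2 ^ M * fact (M + 1) / \<alpha> ^ M * ((\<alpha> * t) ^ (j + M) / fact (j + M))"
    by (simp add: mult.assoc)
  with up show ?thesis by (simp add: distrib_left)
qed

lemma exp_shift_sums:
  fixes x :: real
  shows "summable (\<lambda>k. x ^ (N + k) / fact (N + k))"
    "x \<ge> 0 \<Longrightarrow> (\<Sum>k. x ^ (N + k) / fact (N + k)) \<le> exp x"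
proof -
  have sm: "summable (\<lambda>k. x ^ k / fact k)"
    using summable_exp_generic[of x] by (simp add: divide_inverse mult.commute)
  then show "summable (\<lambda>k. x ^ (N + k) / fact (N + k))"
    using summable_iff_shift[of "\<lambda>k. x ^ k / fact k" N] by (simp add: add.commute)
  assume "x \<ge> 0"
  have "exp x = (\<Sum>k. x ^ k / fact k)"
    by (simp add: exp_def divide_inverse mult.commute)
  also have "\<dots> = (\<Sum>k. x ^ (k + N) / fact (k + N)) + (\<Sum>k<N. x ^ k / fact k)"
    by (rule suminf_split_initial_segment[OF sm])
  finally show "(\<Sum>k. x ^ (N + k) / fact (N + k)) \<le> exp x"
    using \<open>x \<ge> 0\<close> by (simp add: add.commute sum_nonneg)
qed

text \<open>Each of the three series from \<open>poisson_moment_term_le\<close> is a tail of an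
  exponential series. Leaving the terms \<open>a\<close> abstract lets domination give both
  convergence and the bound.\<close>

lemma poisson_moments_bounded:
  fixes \<alpha> :: real
  assumes \<alpha>: "\<alpha> > 0" and N: "N \<ge> 1"
  obtains C where "C \<ge> 0"
    "\<And>t a B. t \<ge> 0 \<Longrightarrow> B \<ge> 0 \<Longrightarrow> (\<And>k. k \<ge> N \<Longrightarrow> \<bar>a k\<bar> \<le> B * ((\<alpha> * t) ^ k / fact k *
        ((real k / jbracket t) ^ M + (jbracket t / real k) ^ M)))
      \<Longrightarrow> exp (- \<alpha> * t) * \<bar>\<Sum>k. a (N + k)\<bar> \<le> C * B"
proof -
  define c where "c = 2 ^ M * fact (M + 1) / \<alpha> ^ M"
  define C where "C = fact M * exp (2 * \<alpha>) + 2 ^ M + c"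
  have c: "c \<ge> 0" using \<alpha> by (simp add: c_def)
  have "exp (- \<alpha> * t) * \<bar>\<Sum>k. a (N + k)\<bar> \<le> C * B"
    if t: "t \<ge> 0" and B: "B \<ge> 0" and a: "\<And>k. k \<ge> N \<Longrightarrow> \<bar>a k\<bar> \<le> B * ((\<alpha> * t) ^ k / fact k *
        ((real k / jbracket t) ^ M + (jbracket t / real k) ^ M))" for t B :: real and a :: "nat \<Rightarrow> real"
  proof -
    let ?x = "\<alpha> * t" and ?y = "\<alpha> * t * exp (1 / jbracket t)"
    have x: "?x \<ge> 0" "?y \<ge> 0" using \<alpha> t by auto
    define e where "e x k = x ^ (N + k) / fact (N + k)" for x :: real and k
    define e' where "e' k = ?x ^ (N + k + M) / fact (N + k + M)" for k
    have e: "summable (e x)" "x \<ge> 0 \<Longrightarrow> suminf (e x) \<le> exp x" for x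
      using exp_shift_sums[of x N] by (auto simp: e_def[abs_def])
    have e': "summable e'" "suminf e' \<le> exp ?x"
      using exp_shift_sums[of ?x "N + M"] x by (auto simp: e'_def[abs_def] add_ac)
    define b where "b k = fact M * e ?y k + 2 ^ M * e ?x k + c * e' k" for k
    have bs: "summable b" unfolding b_def by (intro summable_add summable_mult e e')
    have "norm (a (N + k)) \<le> B * b k" for k
    proof -
      have "\<bar>a (N + k)\<bar> \<le> B * (?x ^ (N + k) / fact (N + k) *
        ((real (N + k) / jbracket t) ^ M + (jbracket t / real (N + k)) ^ M))"
        by (rule a) simp
      also have "\<dots> \<le> B * b k"
        using poisson_moment_term_le[OF \<alpha> t, of "N + k" M] N B
        by (intro mult_left_mono) (simp_all add: b_def e_def e'_def c_def del: fact_Suc of_nat_add)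
      finally show ?thesis by simp
    qed
    then have "norm (\<Sum>k. a (N + k)) \<le> (\<Sum>k. B * b k)"
      by (intro norm_suminf_le summable_mult bs)
    also have "\<dots> = B * (fact M * suminf (e ?y) + 2 ^ M * suminf (e ?x) + c * suminf e')"
      using e e' unfolding suminf_mult[OF bs] b_def
      by (simp add: suminf_add[symmetric] suminf_mult summable_add summable_mult)
    also have "\<dots> \<le> B * (fact M * exp ?y + 2 ^ M * exp ?x + c * exp ?x)"
      using e e' x c B by (intro mult_left_mono add_mono) auto
    finally have "exp (- \<alpha> * t) * \<bar>\<Sum>k. a (N + k)\<bar>
        \<le> exp (- \<alpha> * t) * (B * (fact M * exp ?y + 2 ^ M * exp ?x + c * exp ?x))"
      by (intro mult_left_mono) auto
    also have "\<dots> = B * (fact M * exp (?y - ?x) + 2 ^ M + c)"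
      by (simp add: algebra_simps exp_diff exp_minus divide_inverse)
    also have "\<dots> \<le> B * C"
    proof -
      \<comment> \<open>As exp (1 / \<tau>) - 1 \<le> 2 / \<tau> and t \<le> \<tau>, the tilted
        parameter exceeds \<alpha> t by at most 2 \<alpha>; hence \<open>exp (2 * \<alpha>)\<close>
        in \<open>C\<close>.\<close>
      have \<tau>: "jbracket t \<ge> 1" "t \<le> jbracket t" using jbracket_ge_1 real_le_jbracket by auto
      have "exp (1 / jbracket t) \<le> 1 + 1 / jbracket t + (1 / jbracket t)\<^sup>2"
        using \<tau> by (intro exp_bound) auto
      also have "(1 / jbracket t)\<^sup>2 \<le> 1 / jbracket t"
        using \<tau> by (simp add: power2_eq_square divide_simps)
      finally have "exp (1 / jbracket t) - 1 \<le> 2 / jbracket t" by simp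
      then have "?x * (exp (1 / jbracket t) - 1) \<le> ?x * (2 / jbracket t)"
        using x by (intro mult_left_mono) auto
      also have "\<dots> = 2 * \<alpha> * (t / jbracket t)" by simp
      also have "\<dots> \<le> 2 * \<alpha> * 1" using \<tau> \<alpha> by (intro mult_left_mono) auto
      finally have "?y - ?x \<le> 2 * \<alpha>" by (simp add: algebra_simps)
      then show ?thesis unfolding C_def using B by (intro mult_left_mono add_mono) auto
    qed
    finally show ?thesis by (simp add: mult.commute)
  qed
  moreover have "C \<ge> 0" using c by (simp add: C_def)
  ultimately show ?thesis using that by blast
qed

section \<open>From the scale of \<open>k\<close> to the scale of \<open>jbracket t\<close>\<close>

lemma powr_mult_one_add_powr_le:
  fixes u p q :: real
  assumes u: "u > 0" and p: "p \<ge> 0" and q: "q \<ge> 0" and M: "real M \<ge> p + q"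
  shows "u powr - p * (1 + u) powr q \<le> 2 powr q * (u ^ M + (1 / u) ^ M)"
proof (cases "u \<ge> 1")
  case True
  have "(1 + u) powr q \<le> (2 * u) powr q" using True q by (intro powr_mono2) auto
  then have "u powr - p * (1 + u) powr q \<le> u powr - p * (2 powr q * u powr q)"
    by (intro mult_left_mono) (auto simp: powr_mult)
  also have "\<dots> = 2 powr q * u powr (q - p)" by (simp add: powr_diff powr_minus divide_inverse)
  also have "\<dots> \<le> 2 powr q * u powr M" using True M p by (intro mult_left_mono powr_mono) auto
  also have "u powr M = u ^ M" using u by (rule powr_realpow)
  also have "2 powr q * u ^ M \<le> 2 powr q * (u ^ M + (1 / u) ^ M)" using u by (intro mult_left_mono) auto
  finally show ?thesis .
next
  case False
  have "(1 + u) powr q \<le> 2 powr q" using False u q by (intro powr_mono2) auto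
  moreover have "u powr - p \<le> u powr - real M"
    using False u M p q by (intro powr_mono') auto
  ultimately have "u powr - p * (1 + u) powr q \<le> u powr - real M * 2 powr q"
    by (intro mult_mono) auto
  also have "u powr - real M = (1 / u) ^ M"
    using u by (simp add: powr_minus powr_realpow power_one_over divide_inverse power_inverse)
  also have "(1 / u) ^ M * 2 powr q \<le> 2 powr q * (u ^ M + (1 / u) ^ M)" using u by (simp add: algebra_simps)
  finally show ?thesis .
qed

text \<open>With u = k / \<tau>, 1 + r / \<tau> \<le> (1 + u) (1 + r / k). Changing the scale thus
  costs only powers of \<open>u\<close> and \<open>1 + u\<close>, which the Poisson moments
  control.\<close>

lemma quadratic_weight_rescale:
  fixes r k \<tau> p q :: real
  assumes r: "r \<ge> 0" and k: "k > 0" and \<tau>: "\<tau> > 0" and p: "p \<ge> 0" and q: "q \<ge> 0" and M: "real M \<ge> p + q"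
  shows "k powr - p * (1 + r / k) powr - q
    \<le> 2 powr q * (\<tau> powr - p * (1 + r / \<tau>) powr - q) * ((k / \<tau>) ^ M + (\<tau> / k) ^ M)"
proof -
  define u where "u = k / \<tau>"
  have u: "u > 0" "k = \<tau> * u" "\<tau> / k = 1 / u" using k \<tau> by (auto simp: u_def)
  have pos: "1 + r / k > 0" "1 + r / \<tau> > 0" "1 + u > 0" using r k \<tau> u by (auto intro: add_pos_nonneg)
  have "1 + r / \<tau> \<le> (1 + u) * (1 + r / k)"
    using r u(1) k \<tau> unfolding u_def by (simp add: field_simps)
  then have "(1 + r / \<tau>) powr q \<le> ((1 + u) * (1 + r / k)) powr q" using q pos by (intro powr_mono2) auto
  also have "\<dots> = (1 + u) powr q * (1 + r / k) powr q" using pos by (simp add: powr_mult)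
  finally have "(1 + r / k) powr - q \<le> (1 + u) powr q * (1 + r / \<tau>) powr - q"
    using pos by (simp add: powr_minus_divide field_simps)
  then have "k powr - p * (1 + r / k) powr - q \<le> k powr - p * ((1 + u) powr q * (1 + r / \<tau>) powr - q)"
    by (intro mult_left_mono) auto
  also have "\<dots> = (\<tau> powr - p * (1 + r / \<tau>) powr - q) * (u powr - p * (1 + u) powr q)"
    using u \<tau> by (simp add: powr_mult)
  also have "\<dots> \<le> (\<tau> powr - p * (1 + r / \<tau>) powr - q) * (2 powr q * (u ^ M + (1 / u) ^ M))"
    by (intro mult_left_mono powr_mult_one_add_powr_le u p q M) auto
  finally show ?thesis unfolding u(3)[symmetric] u_def by (simp add: mult_ac)
qed

text \<open>For \<tau> \<ge> 1 the nested bracket is at most 1 + (1 + |x|^2) / \<tau>, hence at most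
  twice the quadratic weight.\<close>

lemma quadratic_weight_le_jbracket:
  fixes x :: "'a::real_normed_vector"
  assumes \<tau>: "\<tau> \<ge> 1" and q: "q \<ge> 0"
  shows "(1 + (norm x)\<^sup>2 / \<tau>) powr - q \<le> 2 powr q * jbracket ((jbracket x)\<^sup>2 / \<tau>) powr - q"
proof -
  let ?z = "(jbracket x)\<^sup>2 / \<tau>"
  have "?z = 1 / \<tau> + (norm x)\<^sup>2 / \<tau>" by (simp add: jbracket_def add_divide_distrib)
  moreover have "1 / \<tau> \<le> 1" using \<tau> by simp
  ultimately have z: "?z \<le> 1 + (norm x)\<^sup>2 / \<tau>" by linarith
  have "jbracket ?z \<le> 1 + ?z" using \<tau> by (intro jbracket_real_le) auto
  also have "\<dots> \<le> 2 * (1 + (norm x)\<^sup>2 / \<tau>)" using z \<tau> by (smt (verit) divide_nonneg_nonneg zero_le_power2)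
  finally have "jbracket ?z powr q \<le> (2 * (1 + (norm x)\<^sup>2 / \<tau>)) powr q"
    using q jbracket_pos[of ?z] by (intro powr_mono2) auto
  also have "\<dots> = 2 powr q * (1 + (norm x)\<^sup>2 / \<tau>) powr q" by (rule powr_mult)
  moreover have "1 + (norm x)\<^sup>2 / \<tau> > 0" using \<tau> by (auto intro: add_pos_nonneg)
  ultimately show ?thesis using jbracket_pos[of ?z] by (simp add: powr_minus_divide field_simps)
qed

section \<open>The remainder\<close>

lemma AE_lborel_diff:
  fixes c :: "'a::euclidean_space"
  assumes "AE x in lborel. P x"
  shows "AE x in lborel. P (c - x)"
proof -
  obtain S where S: "{x \<in> space lborel. \<not> P x} \<subseteq> S" "emeasure lborel S = 0" "S \<in> sets lborel"
    using assms by (rule AE_E)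
  have [measurable]: "S \<in> sets borel" using S by simp
  have "emeasure lborel {x. c - x \<in> S} = (\<integral>\<^sup>+x. indicator {x. c - x \<in> S} x \<partial>lborel)" by simp
  also have "\<dots> = (\<integral>\<^sup>+x. indicator S (c - x) \<partial>lborel)"
    by (intro nn_integral_cong) (simp add: indicator_def)
  also have "\<dots> = (\<integral>\<^sup>+x. indicator S x \<partial>lborel)" by (rule nn_integral_lborel_diff) measurable
  finally have "emeasure lborel {x. c - x \<in> S} = 0" using S by simp
  moreover have "{x. c - x \<in> S} \<in> sets lborel" by measurable
  ultimately show ?thesis using S(1) by (intro AE_I[of _ _ "{x. c - x \<in> S}"]) auto
qed

text \<open>Where the integrand is not integrable, the convolution has the default value 0 and the
  bound is trivial. The null sets of the assumptions vanish under the integral, so the conclusion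
  holds at every \<open>x\<close>.\<close>

lemma abs_convolution_le:
  assumes "AE z in lborel. ennreal \<bar>a z\<bar> \<le> A z" "AE y in lborel. ennreal \<bar>b y\<bar> \<le> B y"
  shows "ennreal \<bar>convolution a b x\<bar> \<le> nnconv A B x"
proof -
  have "ennreal \<bar>convolution a b x\<bar> \<le> (\<integral>\<^sup>+y. ennreal \<bar>a (x - y) * b y\<bar> \<partial>lebesgue)"
  proof (cases "integrable lebesgue (\<lambda>y. a (x - y) * b y)")
    case True
    from integral_norm_bound_ennreal[OF this] show ?thesis by (simp add: convolution_def)
  qed (simp add: convolution_def not_integrable_integral_eq)
  also have "\<dots> = (\<integral>\<^sup>+y. ennreal \<bar>a (x - y) * b y\<bar> \<partial>lborel)" by (rule nn_integral_completion)
  also have "\<dots> \<le> (\<integral>\<^sup>+y. A (x - y) * B y \<partial>lborel)"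
  proof (rule nn_integral_mono_AE)
    show "AE y in lborel. ennreal \<bar>a (x - y) * b y\<bar> \<le> A (x - y) * B y"
      using AE_lborel_diff[OF assms(1), of x] assms(2)
      by eventually_elim (auto simp: abs_mult ennreal_mult intro: mult_mono)
  qed
  finally show ?thesis by (simp add: nnconv_def)
qed

text \<open>\<open>k \<ge> 1\<close> guarantees at least one convolution, which upgrades the bound
  on \<open>J\<close> from almost everywhere to everywhere.\<close>

lemma abs_conv_power_le:
  assumes G: "AE x in lborel. ennreal \<bar>J x\<bar> \<le> G x" and k: "k \<ge> 1"
  shows "ennreal \<bar>conv_power J (Suc k) x\<bar> \<le> nnconv_pow G k x"
  using k
proof (induction k arbitrary: x rule: dec_induct)
  case base
  show ?case using abs_convolution_le[OF G G] by simp
next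
  case (step k)
  have "AE z in lborel. ennreal \<bar>conv_power J (Suc k) z\<bar> \<le> nnconv_pow G k z" using step.IH by simp
  from abs_convolution_le[OF this G] show ?case by simp
qed

lemma nnconv_pow_scale:
  fixes f :: "'a::euclidean_space \<Rightarrow> ennreal"
  assumes [measurable]: "f \<in> borel_measurable borel"
  shows "nnconv_pow (\<lambda>x. c * f x) k x = c ^ Suc k * nnconv_pow f k x"
proof (induction k arbitrary: x)
  case (Suc k)
  have "nnconv_pow (\<lambda>x. c * f x) (Suc k) x = (\<integral>\<^sup>+y. c ^ Suc (Suc k) * (nnconv_pow f k (x - y) * f y) \<partial>lborel)"
    by (simp add: nnconv_def Suc.IH mult_ac)
  also have "\<dots> = c ^ Suc (Suc k) * nnconv_pow f (Suc k) x"
    by (simp add: nnconv_def nn_integral_cmult del: power_Suc)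
  finally show ?case .
qed simp

lemma weighted_L_representative_finite:
  assumes J: "J \<in> weighted_L q b" and g: "AE x in lborel. \<bar>J x\<bar> = g x"
  shows "(\<integral>\<^sup>+x. ennreal ((jbracket x powr b * g x) powr q) \<partial>lborel) < \<infinity>"
proof -
  have "(\<integral>\<^sup>+x. ennreal ((jbracket x powr b * g x) powr q) \<partial>lborel)
      = (\<integral>\<^sup>+x. ennreal (\<bar>jbracket x powr b * J x\<bar> powr q) \<partial>lborel)"
    using g by (intro nn_integral_cong_AE) (auto simp: abs_mult)
  also have "\<dots> = (\<integral>\<^sup>+x. ennreal (norm (\<bar>jbracket x powr b * J x\<bar> powr q)) \<partial>lebesgue)"
    by (simp add: nn_integral_completion)
  also have "\<dots> < \<infinity>"
    using J unfolding weighted_L_def by (auto simp: integrable_iff_bounded)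
  finally show ?thesis .
qed

text \<open>Averaging a Borel version of \<open>J\<close> with its reflection makes evenness hold at
  every point, as the convolution estimates demand.\<close>

lemma even_borel_representative:
  fixes J :: "'a::euclidean_space \<Rightarrow> real"
  assumes "J \<in> borel_measurable lebesgue" and even: "\<And>x. J (- x) = J x"
  obtains g where "g \<in> borel_measurable borel" "\<And>x. g x \<ge> 0" "\<And>x. g (- x) = g x"
    "AE x in lborel. \<bar>J x\<bar> = g x"
proof -
  obtain h where [measurable]: "h \<in> borel_measurable lborel" and h: "AE x in lborel. J x = h x"
    using completion_ex_borel_measurable_real assms(1) by blast
  define g where "g x = (\<bar>h x\<bar> + \<bar>h (- x)\<bar>) / 2" for x
  have "AE x in lborel. J (- x) = h (- x)" using AE_lborel_diff[OF h, of 0] by simp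
  with h have "AE x in lborel. \<bar>J x\<bar> = g x"
    by eventually_elim (simp add: g_def even)
  moreover have "g \<in> borel_measurable borel" unfolding g_def[abs_def] by measurable
  ultimately show ?thesis using that[of g] by (auto simp: g_def add.commute)
qed

lemma conv_power_local_decay:
  fixes J :: "'a::euclidean_space \<Rightarrow> real"
  assumes even: "\<And>x. J (- x) = J x" and \<beta>: "\<beta> \<ge> 0" and \<epsilon>: "\<epsilon> > 0" and N: "real N \<ge> 1 / \<epsilon> + 1"
    and J: "J \<in> weighted_L 1 (2 + \<beta>)" "J \<in> weighted_L (1 + \<epsilon>) \<beta>"
    and nz: "L1_norm J \<noteq> 0"
  shows "\<exists>C\<ge>0. \<forall>k\<ge>N. \<forall>x. \<bar>conv_power J k x\<bar>
    \<le> L1_norm J ^ k * C * (k powr (- real DIM('a) / 2) * (1 + (norm x)\<^sup>2 / k) powr (- (\<beta> / 2)))"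
proof -
  define \<alpha> where "\<alpha> = L1_norm J"
  have Jm: "J \<in> borel_measurable lebesgue" using J by (simp add: weighted_L_def)
  obtain G where [measurable]: "G \<in> borel_measurable borel" and G: "\<And>x. G x \<ge> 0" "\<And>x. G (- x) = G x"
    "AE x in lborel. \<bar>J x\<bar> = G x"
    using even_borel_representative[OF Jm even] by blast
  have L1: "(\<integral>\<^sup>+x. ennreal (jbracket x powr (2 + \<beta>) * G x) \<partial>lborel) < \<infinity>"
    using weighted_L_representative_finite[OF J(1) G(3)] G(1) by simp
  have Lq: "(\<integral>\<^sup>+x. ennreal ((jbracket x powr \<beta> * G x) powr (1 + \<epsilon>)) \<partial>lborel) < \<infinity>"
    by (rule weighted_L_representative_finite[OF J(2) G(3)])
  have \<alpha>: "\<alpha> > 0"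
    using nz unfolding \<alpha>_def L1_norm_def by (simp add: less_le)
  have G_int: "(\<integral>\<^sup>+x. ennreal (G x) \<partial>lborel) = ennreal \<alpha>"
  proof -
    \<comment> \<open>A nonzero Bochner integral is not the default value, so the integrand is
      integrable.\<close>
    have "integrable lebesgue (\<lambda>x. \<bar>J x\<bar>)"
      using nz not_integrable_integral_eq unfolding L1_norm_def by blast
    then have "ennreal \<alpha> = (\<integral>\<^sup>+x. ennreal \<bar>J x\<bar> \<partial>lebesgue)"
      unfolding \<alpha>_def L1_norm_def by (intro nn_integral_eq_integral[symmetric]) auto
    also have "\<dots> = (\<integral>\<^sup>+x. ennreal \<bar>J x\<bar> \<partial>lborel)" by (rule nn_integral_completion)
    also have "\<dots> = (\<integral>\<^sup>+x. ennreal (G x) \<partial>lborel)"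
      using G(3) by (intro nn_integral_cong_AE) auto
    finally show ?thesis ..
  qed
  define g where "g x = G x / \<alpha>" for x
  have [measurable]: "g \<in> borel_measurable borel" unfolding g_def[abs_def] by measurable
  have Gg: "ennreal (G x) = ennreal \<alpha> * ennreal (g x)" for x
    using \<alpha> G(1) by (simp add: g_def ennreal_mult[symmetric])
  have gG: "ennreal (c * G x / \<alpha>) = ennreal (1 / \<alpha>) * ennreal (c * G x)" for x c
    using \<alpha> by (simp add: ennreal_mult'[symmetric])
  have g_int: "(\<integral>\<^sup>+x. ennreal (g x) \<partial>lborel) = 1"
  proof -
    have "(\<integral>\<^sup>+x. ennreal (g x) \<partial>lborel) = (\<integral>\<^sup>+x. ennreal (1 / \<alpha>) * ennreal (G x) \<partial>lborel)"
      using gG[of 1] by (simp add: g_def)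
    also have "\<dots> = ennreal (1 / \<alpha>) * ennreal \<alpha>" by (simp add: nn_integral_cmult G_int)
    finally show ?thesis using \<alpha> by (simp add: ennreal_mult[symmetric])
  qed
  have g1: "(\<integral>\<^sup>+x. ennreal (jbracket x powr (2 + \<beta>) * g x) \<partial>lborel) < \<infinity>"
  proof -
    have "(\<integral>\<^sup>+x. ennreal (jbracket x powr (2 + \<beta>) * g x) \<partial>lborel)
        = (\<integral>\<^sup>+x. ennreal (1 / \<alpha>) * ennreal (jbracket x powr (2 + \<beta>) * G x) \<partial>lborel)"
      by (simp add: g_def gG)
    also have "\<dots> = ennreal (1 / \<alpha>) * (\<integral>\<^sup>+x. ennreal (jbracket x powr (2 + \<beta>) * G x) \<partial>lborel)"
      by (rule nn_integral_cmult) measurable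
    finally show ?thesis using L1 by (simp add: ennreal_mult_less_top)
  qed
  have gq: "(\<integral>\<^sup>+x. ennreal ((jbracket x powr \<beta> * g x) powr (1 + \<epsilon>)) \<partial>lborel) < \<infinity>"
  proof -
    have "(jbracket x powr \<beta> * g x) powr (1 + \<epsilon>)
        = (1 / \<alpha>) powr (1 + \<epsilon>) * (jbracket x powr \<beta> * G x) powr (1 + \<epsilon>)" for x
      unfolding powr_mult[symmetric] by (simp add: g_def)
    then have "(\<integral>\<^sup>+x. ennreal ((jbracket x powr \<beta> * g x) powr (1 + \<epsilon>)) \<partial>lborel)
        = (\<integral>\<^sup>+x. ennreal ((1 / \<alpha>) powr (1 + \<epsilon>)) * ennreal ((jbracket x powr \<beta> * G x) powr (1 + \<epsilon>)) \<partial>lborel)"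
      by (simp add: ennreal_mult)
    also have "\<dots> = ennreal ((1 / \<alpha>) powr (1 + \<epsilon>)) * (\<integral>\<^sup>+x. ennreal ((jbracket x powr \<beta> * G x) powr (1 + \<epsilon>)) \<partial>lborel)"
      by (rule nn_integral_cmult) measurable
    finally show ?thesis using Lq by (simp add: ennreal_mult_less_top)
  qed
  have N1: "N \<ge> 2"
  proof -
    have "1 / \<epsilon> > 0" using \<epsilon> by simp
    then have "real N > 1" using N by linarith
    then show ?thesis by simp
  qed
  \<comment> \<open>\<open>nnconv_pow\<close> at index \<open>N - 1\<close> has \<open>N\<close>
    factors, which accounts for the extra 1 in the bound on \<open>N\<close>.\<close>
  have N2: "real (N - 1) \<ge> 1 / \<epsilon>" using N N1 by (simp add: of_nat_diff)
  obtain C where C: "C \<ge> 0" "\<And>k x. k \<ge> N - 1 \<Longrightarrow>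
      ennreal ((1 + (norm x)\<^sup>2 / Suc k) powr (\<beta> / 2)) * nnconv_pow (\<lambda>x. ennreal (g x)) k x
      \<le> ennreal (C * (Suc k) powr (- real DIM('a) / 2))"
    using nnconv_pow_local_decay[of g \<beta> \<epsilon> "N - 1"] G(1,2) \<alpha> g_int \<beta> \<epsilon> g1 gq N2 by (auto simp: g_def)
  have "\<bar>conv_power J k x\<bar>
    \<le> \<alpha> ^ k * C * (k powr (- real DIM('a) / 2) * (1 + (norm x)\<^sup>2 / k) powr (- (\<beta> / 2)))" if k: "k \<ge> N" for k x
  proof -
    obtain l where l: "k = Suc l" "l \<ge> 1" "l \<ge> N - 1" using k N1 by (cases k) auto
    let ?W = "(1 + (norm x)\<^sup>2 / k) powr (\<beta> / 2)" and ?K = "k powr (- real DIM('a) / 2)"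
    have "1 + (norm x)\<^sup>2 / k > 0" by (intro add_pos_nonneg) auto
    then have W: "?W > 0" by simp
    have GJ: "AE x in lborel. ennreal \<bar>J x\<bar> \<le> ennreal (G x)" using G(3) by eventually_elim simp
    have "ennreal (?W * \<bar>conv_power J k x\<bar>) \<le> ennreal ?W * nnconv_pow (\<lambda>x. ennreal (G x)) l x"
      using abs_conv_power_le[OF GJ l(2), of x] unfolding l(1)
      by (subst ennreal_mult) (auto intro: mult_left_mono)
    also have "\<dots> = ennreal \<alpha> ^ k * (ennreal ?W * nnconv_pow (\<lambda>x. ennreal (g x)) l x)"
      unfolding Gg by (subst nnconv_pow_scale) (auto simp: l(1) mult_ac)
    also have "\<dots> \<le> ennreal \<alpha> ^ k * ennreal (C * ?K)"
      using C(2)[OF l(3), of x] unfolding l(1) by (intro mult_left_mono) auto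
    also have "\<dots> = ennreal (\<alpha> ^ k * (C * ?K))"
      using \<alpha> C by (simp add: ennreal_power ennreal_mult)
    finally have "?W * \<bar>conv_power J k x\<bar> \<le> \<alpha> ^ k * (C * ?K)"
      using \<alpha> C by simp
    then have "\<bar>conv_power J k x\<bar> \<le> \<alpha> ^ k * (C * ?K) / ?W" using W by (simp add: field_simps)
    then show ?thesis by (simp add: powr_minus_divide mult_ac)
  qed
  with C(1) show ?thesis unfolding \<alpha>_def by blast
qed

text \<open>The default value of the Bochner integral makes \<open>L1_norm J = 0\<close> ambiguous,
  so integrability is first drawn from the weighted space. \<open>J\<close> may still be nonzero on
  a null set, whence \<open>k \<ge> 2\<close>.\<close>

lemma conv_power_eq_0:
  assumes "J \<in> weighted_L 1 b" "b \<ge> 0" "L1_norm J = 0" "k \<ge> 2"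
  shows "conv_power J k x = 0"
proof -
  have Jm [measurable]: "J \<in> borel_measurable lebesgue" using assms by (simp add: weighted_L_def)
  have "integrable lebesgue (\<lambda>x. \<bar>J x\<bar>)"
  proof (rule Bochner_Integration.integrable_bound)
    show "integrable lebesgue (\<lambda>x. \<bar>jbracket x powr b * J x\<bar> powr 1)"
      using assms by (simp add: weighted_L_def)
    show "AE x in lebesgue. norm \<bar>J x\<bar> \<le> norm (\<bar>jbracket x powr b * J x\<bar> powr 1)"
    proof (rule AE_I2)
      fix x :: 'a
      have "1 * \<bar>J x\<bar> \<le> jbracket x powr b * \<bar>J x\<bar>"
        using assms(2) jbracket_ge_1[of x] by (intro mult_right_mono) (auto simp: ge_one_powr_ge_zero)
      then show "norm \<bar>J x\<bar> \<le> norm (\<bar>jbracket x powr b * J x\<bar> powr 1)" by (simp add: abs_mult)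
    qed
  qed simp
  then have "AE x in lebesgue. \<bar>J x\<bar> = 0"
    using assms(3) integral_nonneg_eq_0_iff_AE[of lebesgue "\<lambda>x. \<bar>J x\<bar>"] by (simp add: L1_norm_def)
  then have "AE x in lborel. ennreal \<bar>J x\<bar> \<le> 0" by (simp add: AE_completion_iff)
  moreover obtain l where "k = Suc l" "l \<ge> 1" using assms(4) by (cases k) auto
  ultimately have "ennreal \<bar>conv_power J k x\<bar> \<le> nnconv_pow (\<lambda>_. 0) l x"
    using abs_conv_power_le[of J "\<lambda>_. 0" l x] by simp
  moreover have "nnconv_pow (\<lambda>_::'a. 0) l x = 0"
    using \<open>l \<ge> 1\<close> by (cases l) (auto simp: nnconv_def)
  ultimately show ?thesis by simp
qed

lemma remainder_bound:
  fixes J :: "'a::euclidean_space \<Rightarrow> real"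
  assumes even: "\<And>x. J (- x) = J x" and \<beta>: "\<beta> \<ge> 0" and \<epsilon>: "\<epsilon> > 0" and N: "real N \<ge> 1 / \<epsilon> + 1"
    and J: "J \<in> weighted_L 1 (2 + \<beta>)" "J \<in> weighted_L (1 + \<epsilon>) \<beta>"
  shows "\<exists>C. \<forall>x. \<forall>t\<ge>0. \<bar>remainder J N x t\<bar>
    \<le> C * jbracket ((jbracket x)\<^sup>2 / jbracket t) powr (- \<beta> / 2) * jbracket t powr (- real DIM('a) / 2)"
proof (cases "L1_norm J = 0")
  case True
  have "1 / \<epsilon> > 0" using \<epsilon> by simp
  then have "real N > 1" using N by linarith
  then have "conv_power J (N + k) x = 0" for k x using \<beta> by (intro conv_power_eq_0[OF J(1) _ True]) auto
  then have "remainder J N x t = 0" for x t by (simp add: remainder_def)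
  then show ?thesis by (intro exI[of _ 0]) simp
next
  case False
  define \<alpha> where "\<alpha> = L1_norm J"
  define p where "p = real DIM('a) / 2"
  define q where "q = \<beta> / 2"
  \<comment> \<open>Rescaling costs powers of \<open>k / jbracket t\<close> and its inverse up to
    order p + q; the Poisson moments are available for integer orders.\<close>
  define M where "M = nat \<lceil>p + q\<rceil>"
  have pq: "p \<ge> 0" "q \<ge> 0" "real M \<ge> p + q" using \<beta> by (auto simp: p_def q_def M_def)
  have \<alpha>: "\<alpha> > 0" using False unfolding \<alpha>_def L1_norm_def by (simp add: less_le)
  have "1 / \<epsilon> > 0" using \<epsilon> by simp
  then have "real N > 1" using N by linarith
  then have N1: "N \<ge> 1" by simp
  obtain C where C: "C \<ge> 0" "\<And>k x. k \<ge> N \<Longrightarrow> \<bar>conv_power J k x\<bar>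
      \<le> \<alpha> ^ k * C * (k powr - p * (1 + (norm x)\<^sup>2 / k) powr - q)"
    using conv_power_local_decay[OF even \<beta> \<epsilon> N J False] unfolding \<alpha>_def p_def q_def by auto
  obtain D where D: "D \<ge> 0"
    "\<And>t a B. t \<ge> 0 \<Longrightarrow> B \<ge> 0 \<Longrightarrow> (\<And>k. k \<ge> N \<Longrightarrow> \<bar>a k\<bar> \<le> B * ((\<alpha> * t) ^ k / fact k *
        ((real k / jbracket t) ^ M + (jbracket t / real k) ^ M)))
      \<Longrightarrow> exp (- \<alpha> * t) * \<bar>\<Sum>k. a (N + k)\<bar> \<le> D * B"
    using poisson_moments_bounded[OF \<alpha> N1, of M] by blast
  have "\<bar>remainder J N x t\<bar> \<le> (D * (C * (2 powr q * 2 powr q))) *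
      jbracket ((jbracket x)\<^sup>2 / jbracket t) powr - q * jbracket t powr - p" if t: "t \<ge> 0" for x t
  proof -
    let ?\<tau> = "jbracket t" and ?B = "C * (2 powr q * (jbracket t powr - p * (1 + (norm x)\<^sup>2 / jbracket t) powr - q))"
    have \<tau>: "?\<tau> > 0" "?\<tau> \<ge> 1" using jbracket_pos jbracket_ge_1 by auto
    have "\<bar>remainder J N x t\<bar> = exp (- \<alpha> * t) * \<bar>\<Sum>k. t ^ (N + k) / fact (N + k) * conv_power J (N + k) x\<bar>"
      by (simp add: remainder_def abs_mult \<alpha>_def)
    also have "\<dots> \<le> D * ?B"
    proof (rule D(2)[OF t, where a = "\<lambda>k. t ^ k / fact k * conv_power J k x"])
      fix k assume k: "k \<ge> N"
      have "\<bar>t ^ k / fact k * conv_power J k x\<bar> = t ^ k / fact k * \<bar>conv_power J k x\<bar>"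
        using t by (simp add: abs_mult)
      also have "\<dots> \<le> t ^ k / fact k * (\<alpha> ^ k * C * (k powr - p * (1 + (norm x)\<^sup>2 / k) powr - q))"
        using t by (intro mult_left_mono C k) auto
      \<comment> \<open>After rescaling, \<open>k\<close> survives only in the Poisson weight and
        the ratios, so the profile in \<open>x\<close> and \<open>t\<close> leaves the sum as
        \<open>?B\<close>.\<close>
      also have "\<dots> \<le> t ^ k / fact k * (\<alpha> ^ k * C * (2 powr q * (?\<tau> powr - p * (1 + (norm x)\<^sup>2 / ?\<tau>) powr - q)
          * ((k / ?\<tau>) ^ M + (?\<tau> / k) ^ M)))"
        using t \<alpha> C k N1 \<tau> pq by (intro mult_left_mono quadratic_weight_rescale) auto
      also have "\<dots> = ?B * ((\<alpha> * t) ^ k / fact k * ((k / ?\<tau>) ^ M + (?\<tau> / k) ^ M))"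
        by (simp add: power_mult_distrib mult_ac)
      finally show "\<bar>t ^ k / fact k * conv_power J k x\<bar>
          \<le> ?B * ((\<alpha> * t) ^ k / fact k * ((k / ?\<tau>) ^ M + (?\<tau> / k) ^ M))" .
    qed (use C in auto)
    also have "\<dots> \<le> D * (C * (2 powr q * (?\<tau> powr - p * (2 powr q * jbracket ((jbracket x)\<^sup>2 / ?\<tau>) powr - q))))"
      using C D \<tau> pq by (intro mult_left_mono quadratic_weight_le_jbracket) auto
    finally show ?thesis by (simp add: mult_ac)
  qed
  then show ?thesis unfolding p_def q_def by (auto intro!: exI[of _ "D * (C * (2 powr (\<beta> / 2) * 2 powr (\<beta> / 2)))"])
qed

theorem proposition5p1:
  fixes J :: "real ^ 'n \<Rightarrow> real" and \<epsilon>0 :: real and N :: nat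
  assumes "radially_symmetric J"
    and "\<epsilon>0 > 0"
    and "int N \<ge> \<lceil>1 / \<epsilon>0\<rceil> + 1"
  shows "(\<forall>\<beta>\<ge>0. J \<in> weighted_L 1 (2 + \<beta>) \<inter> weighted_L (1 + \<epsilon>0) \<beta> \<longrightarrow>
      (\<exists>C. \<forall>x. \<forall>t\<ge>0. \<bar>remainder J N x t\<bar>
        \<le> C * jbracket ((jbracket x)\<^sup>2 / jbracket t) powr (- \<beta> / 2)
            * jbracket t powr (- real CARD('n) / 2)))
    \<and> (J \<in> weighted_L_inf 1 \<inter> weighted_L_inf (1 + \<epsilon>0) \<longrightarrow>
      (\<forall>\<beta>\<ge>0. \<exists>C. \<forall>x. \<forall>t\<ge>0. \<bar>remainder J N x t\<bar>
        \<le> C * jbracket ((jbracket x)\<^sup>2 / jbracket t) powr (- \<beta> / 2)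
            * jbracket t powr (- real CARD('n) / 2)))"
proof -
  have even: "J (- x) = J x" for x
    using assms(1) unfolding radially_symmetric_def by (metis norm_minus_cancel)
  have N: "real N \<ge> 1 / \<epsilon>0 + 1" using assms(3) by linarith
  have "\<exists>C. \<forall>x. \<forall>t\<ge>0. \<bar>remainder J N x t\<bar>
        \<le> C * jbracket ((jbracket x)\<^sup>2 / jbracket t) powr (- \<beta> / 2) * jbracket t powr (- real CARD('n) / 2)"
    if "\<beta> \<ge> 0" "J \<in> weighted_L 1 (2 + \<beta>)" "J \<in> weighted_L (1 + \<epsilon>0) \<beta>" for \<beta>
    using remainder_bound[OF even that(1) assms(2) N that(2,3)] by simp
  then show ?thesis unfolding weighted_L_inf_def by blast
qed

end
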